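(* Let $\underline{\mathbf d}=(a_1,\dots,a_r,b_1,b_2;n)$ be a dimension vector with $\sum_{i=1}^r a_i=n-k<n$, $k\le b_1,b_2$, and $b_1+b_2<n$. Set $m=b_1+b_2-k$, and suppose $a_i\le m$ for all $i$. Then $\underline{\mathbf d}$ is dense if the dimension vector $\underline{\mathbf d}'=(a_1,\dots,a_r,b_1,b_2;m)$ is dense.
   Context: Work over an algebraically closed field of arbitrary characteristic. $Gr(d;n)$ is the Grassmannian of $d$-dimensional linear subspaces of a fixed $n$-dimensional vector space. A dimension vector $(d_1,\dots,d_s;n)$ consists of integers with $1\le d_i\le n-1$; it is dense if the diagonal action of $\mathbb{P}GL(n)$ on $\prod_{i} Gr(d_i;n)$ has a Zariski dense orbit. In the vector $\underline{\mathbf d}'$, entries equal to the ambient dimension $m$ are allowed; the corresponding Grassmannian is a point, so such entries can be dropped. Here $r\ge 1$. *)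

theory Defs
  imports
    "HOL-Algebra.Group_Action"
    "Jordan_Normal_Form.VS_Connect"
    "Jordan_Normal_Form.DL_Submatrix"
begin

definition dimension_vector :: "nat list \<Rightarrow> nat \<Rightarrow> bool" where
  "dimension_vector ds n \<longleftrightarrow> (\<forall>d \<in> set ds. 1 \<le> d \<and> d \<le> n - 1)"

subsection \<open>Grassmannians\<close>

definition Gr :: "nat \<Rightarrow> nat \<Rightarrow> 'a::field vec set set" where
  "Gr d n = {U. VectorSpace.subspace class_ring U (module_vec TYPE('a) n) \<and>
                vectorspace.dim class_ring (module_vec TYPE('a) n\<lparr>carrier := U\<rparr>) = d}"

text \<open>Points of a product of Grassmannians are lists of subspaces.\<close>

definition Gr_prod :: "nat list \<Rightarrow> nat \<Rightarrow> 'a::field vec set list set" where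
  "Gr_prod ds n = listset (map (\<lambda>d. Gr d n) ds)"

subsection \<open>The diagonal action of the projective linear group\<close>

definition GL :: "'a::field itself \<Rightarrow> nat \<Rightarrow> 'a mat monoid" where
  "GL ty n = units_of (ring_mat ty n ())"

definition PGL :: "'a::field itself \<Rightarrow> nat \<Rightarrow> 'a mat set monoid" where
  "PGL ty n = GL ty n Mod {c \<cdot>\<^sub>m 1\<^sub>m n | c. c \<noteq> 0}"

text \<open>An element of the projective linear group is a coset \<open>\<gamma>\<close> of invertible matrices that differ
  by nonzero scalars. All \<open>g \<in> \<gamma>\<close> map a subspace \<open>U\<close> to the same image, so the union below is
  \<open>g U\<close> for any representative \<open>g\<close>.\<close>

definition PGL_act :: "'a::field mat set \<Rightarrow> 'a vec set \<Rightarrow> 'a vec set" where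
  "PGL_act \<gamma> U = (\<Union>g\<in>\<gamma>. (\<lambda>v. g *\<^sub>v v) ` U)"

definition PGL_orbit :: "nat \<Rightarrow> 'a::field vec set list \<Rightarrow> 'a vec set list set" where
  "PGL_orbit n Us = orbit (PGL TYPE('a) n) (\<lambda>\<gamma>. map (PGL_act \<gamma>)) Us"

subsection \<open>The Zariski topology\<close>

text \<open>A product of Grassmannians is a closed subvariety of a product of projective spaces via the
  Pluecker embeddings of its factors. Coordinate \<open>(i, J)\<close> is the maximal minor with row set \<open>J\<close>
  of a matrix whose columns form a basis of the \<open>i\<close>-th subspace.\<close>

definition basis_matrix :: "nat \<Rightarrow> 'a::field vec set \<Rightarrow> 'a mat \<Rightarrow> bool" where
  "basis_matrix n U M \<longleftrightarrow> dim_row M = n \<and> distinct (cols M) \<and>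
     vectorspace.basis class_ring (module_vec TYPE('a) n\<lparr>carrier := U\<rparr>) (set (cols M))"

definition pluecker :: "'a::field mat list \<Rightarrow> nat \<times> nat set \<Rightarrow> 'a" where
  "pluecker Ms = (\<lambda>(i, J). det (submatrix (Ms ! i) J UNIV))"

text \<open>Polynomials in the Pluecker coordinates that are homogeneous of degree \<open>e i\<close> in the
  coordinates of each factor \<open>i\<close>. They are represented by their polynomial functions, which over
  an infinite field (in particular an algebraically closed one) is no loss.\<close>

inductive multihomogeneous ::
    "nat list \<Rightarrow> nat \<Rightarrow> (nat \<Rightarrow> nat) \<Rightarrow> ((nat \<times> nat set \<Rightarrow> 'a::field) \<Rightarrow> 'a) \<Rightarrow> bool"
  for ds :: "nat list" and n :: nat where
  const: "multihomogeneous ds n (\<lambda>_. 0) (\<lambda>_. c)"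
| var: "i < length ds \<Longrightarrow> J \<subseteq> {..<n} \<Longrightarrow> card J = ds ! i \<Longrightarrow>
    multihomogeneous ds n (\<lambda>j. if j = i then 1 else 0) (\<lambda>p. p (i, J))"
| add: "multihomogeneous ds n e F \<Longrightarrow> multihomogeneous ds n e G \<Longrightarrow>
    multihomogeneous ds n e (\<lambda>p. F p + G p)"
| mult: "multihomogeneous ds n e F \<Longrightarrow> multihomogeneous ds n e' G \<Longrightarrow>
    multihomogeneous ds n (\<lambda>j. e j + e' j) (\<lambda>p. F p * G p)"

text \<open>Changing the bases rescales the Pluecker coordinates of each factor, so vanishing of a
  multihomogeneous polynomial does not depend on the basis matrices \<open>Ms\<close>.\<close>

definition zero_locus ::
    "nat list \<Rightarrow> nat \<Rightarrow> ((nat \<times> nat set \<Rightarrow> 'a::field) \<Rightarrow> 'a) set \<Rightarrow> 'a vec set list set" where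
  "zero_locus ds n S = {Us \<in> Gr_prod ds n.
     \<forall>Ms. list_all2 (basis_matrix n) Us Ms \<longrightarrow> (\<forall>F\<in>S. F (pluecker Ms) = 0)}"

definition zariski_closed :: "nat list \<Rightarrow> nat \<Rightarrow> 'a::field vec set list set \<Rightarrow> bool" where
  "zariski_closed ds n Z \<longleftrightarrow>
     (\<exists>S. (\<forall>F\<in>S. \<exists>e. multihomogeneous ds n e F) \<and> Z = zero_locus ds n S)"

definition dense_dimension_vector :: "'a::alg_closed_field itself \<Rightarrow> nat list \<Rightarrow> nat \<Rightarrow> bool" where
  "dense_dimension_vector ty ds n \<longleftrightarrow>
     (\<exists>Us :: 'a vec set list \<in> Gr_prod ds n.
        zariski_closed ds n hull PGL_orbit n Us = Gr_prod ds n)"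

end

theory Submission
  imports Defs "Jordan_Normal_Form.DL_Rank"
begin

text \<open>
  The theorem is a case of castling duality. Put \<open>N = \<Sum>a\<^sub>i + b\<^sub>1 + b\<^sub>2\<close>. The hypotheses give
  \<open>N = (n - k) + (m + k) = n + m\<close>, and every entry of the dimension vector is at most \<open>n\<close> and at most \<open>m\<close>.

  A tuple of subspaces of the \<open>m\<close>-dimensional space, with chosen bases, is an \<open>m \<times> N\<close> matrix \<open>R\<close> whose
  columns come in blocks. Moving the tuple by the general linear group and changing the bases means
  passing from \<open>R\<close> to \<open>g R D\<close> with \<open>g\<close> invertible and \<open>D\<close> invertible and block diagonal. The kernel of
  \<open>R\<close> has dimension \<open>N - m = n\<close>; a basis of it, written as rows, is an \<open>n \<times> N\<close> matrix \<open>Q\<close>, that is, a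
  tuple of subspaces of the same dimensions in the \<open>n\<close>-dimensional space. If \<open>R\<close> is replaced by \<open>g R D\<close>,
  then \<open>Q\<close> is replaced by \<open>g' Q D'\<close>, where \<open>D'\<close> is the transposed inverse of \<open>D\<close>, which is again block
  diagonal. As a generic \<open>Q\<close> arises from a generic \<open>R\<close>, a dense orbit on \<open>m \<times> N\<close> matrices produces a
  dense orbit on \<open>n \<times> N\<close> matrices. This is \<open>orbit_generic_castling\<close>, proved for any group of matrices
  \<open>D\<close> that is stable under transposition; it works with a polynomial formula for the kernel.

  It remains to compare density in a product of Grassmannians with density in the affine space of
  matrices. From matrices to subspaces (\<open>dense_if_orbit_generic\<close>) this is immediate, because Pluecker
  coordinates are polynomials in the entries. For the converse (\<open>orbit_generic_if_dense\<close>) a polynomial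
  on matrices has to be turned into a multihomogeneous polynomial in Pluecker coordinates. This is done
  on the chart where the upper square part \<open>T\<close> of each block \<open>M\<close> is invertible: by Cramer's rule the
  entries of \<open>M T\<inverse>\<close> are quotients of Pluecker coordinates.
\<close>

section \<open>Polynomial functions of matrices\<close>

text \<open>Polynomial functions of the entries of an \<open>m \<times> N\<close> matrix. The rule \<open>cong\<close> identifies functions that
  agree on matrices of that size, because \<open>det\<close>, products and entries take arbitrary values on matrices
  of other sizes.\<close>

inductive mat_poly :: "nat \<Rightarrow> nat \<Rightarrow> ('a::comm_ring_1 mat \<Rightarrow> 'a) \<Rightarrow> bool"
  for m N :: nat where
  const: "mat_poly m N (\<lambda>_. c)"
| entry: "i < m \<Longrightarrow> j < N \<Longrightarrow> mat_poly m N (\<lambda>A. A $$ (i, j))"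
| add: "mat_poly m N f \<Longrightarrow> mat_poly m N g \<Longrightarrow> mat_poly m N (\<lambda>A. f A + g A)"
| mult: "mat_poly m N f \<Longrightarrow> mat_poly m N g \<Longrightarrow> mat_poly m N (\<lambda>A. f A * g A)"
| cong: "mat_poly m N f \<Longrightarrow> (\<And>A. A \<in> carrier_mat m N \<Longrightarrow> f A = g A) \<Longrightarrow> mat_poly m N g"

lemma mat_poly_sum:
  "(\<And>i. i \<in> I \<Longrightarrow> mat_poly m N (f i)) \<Longrightarrow> mat_poly m N (\<lambda>A. \<Sum>i\<in>I. f i A)"
  by (induction I rule: infinite_finite_induct) (auto intro: mat_poly.intros(1,3))

lemma mat_poly_prod:
  "(\<And>i. i \<in> I \<Longrightarrow> mat_poly m N (f i)) \<Longrightarrow> mat_poly m N (\<lambda>A. \<Prod>i\<in>I. f i A)"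
  by (induction I rule: infinite_finite_induct) (auto intro: mat_poly.intros(1,4))

definition poly_map ::
    "nat \<Rightarrow> nat \<Rightarrow> nat \<Rightarrow> nat \<Rightarrow> ('a::comm_ring_1 mat \<Rightarrow> 'a mat) \<Rightarrow> bool" where
  "poly_map m N r c B \<longleftrightarrow>
     (\<forall>A\<in>carrier_mat m N. B A \<in> carrier_mat r c) \<and>
     (\<forall>i<r. \<forall>j<c. mat_poly m N (\<lambda>A. B A $$ (i, j)))"

lemma poly_mapI:
  assumes "\<And>A. A \<in> carrier_mat m N \<Longrightarrow> B A \<in> carrier_mat r c"
    and "\<And>i j. i < r \<Longrightarrow> j < c \<Longrightarrow> mat_poly m N (\<lambda>A. B A $$ (i, j))"
  shows "poly_map m N r c B"
  using assms by (auto simp: poly_map_def)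

lemma poly_map_carrier: "poly_map m N r c B \<Longrightarrow> A \<in> carrier_mat m N \<Longrightarrow> B A \<in> carrier_mat r c"
  by (auto simp: poly_map_def)

lemma poly_map_entry: "poly_map m N r c B \<Longrightarrow> i < r \<Longrightarrow> j < c \<Longrightarrow> mat_poly m N (\<lambda>A. B A $$ (i, j))"
  by (auto simp: poly_map_def)

lemma poly_map_mat:
  assumes "\<And>i j. i < r \<Longrightarrow> j < c \<Longrightarrow> mat_poly m N (\<lambda>A. b A i j)"
  shows "poly_map m N r c (\<lambda>A. mat r c (\<lambda>(i, j). b A i j))"
  using assms by (auto intro!: poly_mapI)

lemma poly_map_const: "B \<in> carrier_mat r c \<Longrightarrow> poly_map m N r c (\<lambda>_. B)"
  by (auto intro!: poly_mapI mat_poly.const)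

lemma poly_map_mult:
  assumes B: "poly_map m N r k B" and C: "poly_map m N k c C"
  shows "poly_map m N r c (\<lambda>A. B A * C A)"
proof (rule poly_mapI)
  show "B A * C A \<in> carrier_mat r c" if "A \<in> carrier_mat m N" for A
    using poly_map_carrier[OF B that] poly_map_carrier[OF C that] by simp
  fix i j assume ij: "i < r" "j < c"
  have "mat_poly m N (\<lambda>A. \<Sum>l\<in>{0..<k}. B A $$ (i, l) * C A $$ (l, j))"
    using ij by (intro mat_poly_sum mat_poly.mult poly_map_entry[OF B] poly_map_entry[OF C]) auto
  then show "mat_poly m N (\<lambda>A. (B A * C A) $$ (i, j))"
  proof (rule mat_poly.cong)
    fix A :: "'a mat" assume A: "A \<in> carrier_mat m N"
    show "(\<Sum>l\<in>{0..<k}. B A $$ (i, l) * C A $$ (l, j)) = (B A * C A) $$ (i, j)"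
      using ij poly_map_carrier[OF B A] poly_map_carrier[OF C A] by (auto simp: scalar_prod_def)
  qed
qed

lemma poly_map_transpose:
  assumes B: "poly_map m N r c B"
  shows "poly_map m N c r (\<lambda>A. (B A)\<^sup>T)"
proof (rule poly_mapI)
  show "(B A)\<^sup>T \<in> carrier_mat c r" if "A \<in> carrier_mat m N" for A
    using poly_map_carrier[OF B that] by auto
  fix i j assume ij: "i < c" "j < r"
  show "mat_poly m N (\<lambda>A. (B A)\<^sup>T $$ (i, j))"
  proof (rule mat_poly.cong[OF poly_map_entry[OF B ij(2,1)]])
    fix A :: "'a mat" assume A: "A \<in> carrier_mat m N"
    show "B A $$ (j, i) = (B A)\<^sup>T $$ (i, j)" using ij poly_map_carrier[OF B A] by simp
  qed
qed

lemma mat_poly_det: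
  assumes B: "poly_map m N d d B"
  shows "mat_poly m N (\<lambda>A. det (B A))"
proof -
  have "mat_poly m N (\<lambda>A. \<Sum>p\<in>{p. p permutes {0..<d}}. signof p * (\<Prod>i = 0..<d. B A $$ (i, p i)))"
    by (intro mat_poly_sum mat_poly.mult mat_poly.const mat_poly_prod poly_map_entry[OF B])
       (auto simp: permutes_def dest: permutes_in_image)
  then show ?thesis
    by (rule mat_poly.cong) (use poly_map_carrier[OF B] in \<open>auto simp: det_def\<close>)
qed

lemma poly_map_adj_mat:
  assumes B: "poly_map m N d d B"
  shows "poly_map m N d d (\<lambda>A. adj_mat (B A))"
proof (rule poly_mapI)
  show "adj_mat (B A) \<in> carrier_mat d d" if "A \<in> carrier_mat m N" for A
    using poly_map_carrier[OF B that] by (rule adj_mat)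
  fix i j assume ij: "i < d" "j < d"
  let ?M = "\<lambda>A. mat (d - 1) (d - 1)
    (\<lambda>(i', j'). B A $$ (if i' < j then i' else Suc i', if j' < i then j' else Suc j'))"
  have "mat_poly m N (\<lambda>A. (- 1) ^ (j + i) * det (?M A))"
    by (intro mat_poly.mult mat_poly.const mat_poly_det[of _ _ "d - 1"] poly_map_mat
        poly_map_entry[OF B]) auto
  then show "mat_poly m N (\<lambda>A. adj_mat (B A) $$ (i, j))"
  proof (rule mat_poly.cong)
    fix A :: "'a mat" assume A: "A \<in> carrier_mat m N"
    show "(- 1) ^ (j + i) * det (?M A) = adj_mat (B A) $$ (i, j)"
      using ij poly_map_carrier[OF B A] by (auto simp: adj_mat_def cofactor_def mat_delete_def)
  qed
qed

lemma mat_poly_compose: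
  assumes f: "mat_poly r c f" and B: "poly_map m N r c B"
  shows "mat_poly m N (\<lambda>A. f (B A))"
  using f
proof induction
  case (cong f g)
  show ?case by (rule mat_poly.cong[OF cong.IH]) (use cong.hyps poly_map_carrier[OF B] in auto)
qed (auto intro: mat_poly.intros(1,3,4) poly_map_entry[OF B])

text \<open>Restriction to a line reduces questions about polynomial functions of matrices to univariate
  polynomials.\<close>

lemma mat_poly_on_line:
  fixes f :: "'a::comm_ring_1 mat \<Rightarrow> 'a"
  assumes f: "mat_poly m N f" and A: "A \<in> carrier_mat m N" and B: "B \<in> carrier_mat m N"
  shows "\<exists>p. \<forall>t. f (A + t \<cdot>\<^sub>m B) = poly p t"
  using f
proof induction
  case (const c)
  show ?case by (rule exI[of _ "[:c:]"]) simp
next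
  case (entry i j)
  show ?case
    by (rule exI[of _ "[:A $$ (i, j), B $$ (i, j):]"]) (use entry A B in auto)
next
  case (add f g)
  then obtain p q where "\<forall>t. f (A + t \<cdot>\<^sub>m B) = poly p t" "\<forall>t. g (A + t \<cdot>\<^sub>m B) = poly q t"
    by blast
  then show ?case by (intro exI[of _ "p + q"]) simp
next
  case (mult f g)
  then obtain p q where "\<forall>t. f (A + t \<cdot>\<^sub>m B) = poly p t" "\<forall>t. g (A + t \<cdot>\<^sub>m B) = poly q t"
    by blast
  then show ?case by (intro exI[of _ "p * q"]) simp
next
  case (cong f g)
  have "A + t \<cdot>\<^sub>m B \<in> carrier_mat m N" for t using A B by simp
  with cong show ?case by metis
qed

text \<open>The space of matrices is irreducible: on the line that joins \<open>A\<close> to a point \<open>B\<close> where \<open>g\<close> does not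
  vanish, \<open>f\<close> and \<open>g\<close> become univariate polynomials with product zero, and the second is nonzero.
  Degenerate loci \<open>g = 0\<close> are discarded in this way.\<close>

lemma mat_poly_eq_0_if_mult_eq_0:
  fixes f :: "'a::field mat \<Rightarrow> 'a"
  assumes inf: "infinite (UNIV :: 'a set)"
    and f: "mat_poly m N f" and g: "mat_poly m N g"
    and fg: "\<And>A. A \<in> carrier_mat m N \<Longrightarrow> f A * g A = 0"
    and B: "B \<in> carrier_mat m N" "g B \<noteq> 0"
    and A: "A \<in> carrier_mat m N"
  shows "f A = 0"
proof -
  have D: "B - A \<in> carrier_mat m N" using A by (rule minus_carrier_mat)
  obtain p q where p: "\<And>t. f (A + t \<cdot>\<^sub>m (B - A)) = poly p t"
    and q: "\<And>t. g (A + t \<cdot>\<^sub>m (B - A)) = poly q t"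
    using mat_poly_on_line[OF f A D] mat_poly_on_line[OF g A D] by blast
  have 0: "A + 0 \<cdot>\<^sub>m (B - A) = A" and 1: "A + 1 \<cdot>\<^sub>m (B - A) = B"
    using A B by (auto intro!: eq_matI)
  have "poly (p * q) t = 0" for t
    using fg[of "A + t \<cdot>\<^sub>m (B - A)"] A D p q by simp
  then have "{t. poly (p * q) t = 0} = UNIV" by auto
  then have "p * q = 0" using inf poly_roots_finite[of "p * q"] by auto
  moreover have "q \<noteq> 0" using q[of 1] 1 B by auto
  ultimately show ?thesis using p[of 0] 0 by auto
qed

text \<open>If the field were finite, one plus the product of all linear factors would have no root.\<close>

lemma infinite_UNIV_alg_closed_field: "infinite (UNIV :: 'a::alg_closed_field set)"
proof
  assume fin: "finite (UNIV :: 'a set)"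
  define p where "p = (\<Prod>a\<in>UNIV. [:- a, 1:]) + (1 :: 'a poly)"
  have "poly p x \<noteq> 0" for x
  proof -
    have "(\<Prod>a\<in>UNIV. x - a) = 0" using fin by (rule prod_zero) (auto intro: bexI[of _ x])
    then show ?thesis by (simp add: p_def poly_prod)
  qed
  moreover have "degree p > 0"
  proof -
    have "degree (\<Prod>a\<in>(UNIV::'a set). [:- a, 1:]) = card (UNIV :: 'a set)"
      by (subst degree_prod_eq_sum_degree) auto
    moreover have "card (UNIV :: 'a set) > 0" using fin by (simp add: card_gt_0_iff)
    ultimately show ?thesis unfolding p_def by (subst degree_add_eq_left) auto
  qed
  ultimately show False using alg_closed_imp_poly_has_root by blast
qed

section \<open>Kernels and castling of dense orbits\<close>

text \<open>The orbit of \<open>R\<close> under row operations and under column operations from \<open>L\<close> is Zariski dense in the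
  affine space of \<open>m \<times> N\<close> matrices.\<close>

definition orbit_generic :: "'a::field mat set \<Rightarrow> nat \<Rightarrow> nat \<Rightarrow> 'a mat \<Rightarrow> bool" where
  "orbit_generic L m N R \<longleftrightarrow> R \<in> carrier_mat m N \<and>
     (\<forall>f. mat_poly m N f \<longrightarrow>
       (\<forall>g\<in>carrier_mat m m. \<forall>D\<in>L. det g \<noteq> 0 \<longrightarrow> f (g * R * D) = 0) \<longrightarrow>
       (\<forall>A\<in>carrier_mat m N. f A = 0))"

lemma orbit_genericD:
  assumes "orbit_generic L m N R" and "mat_poly m N f"
    and "\<And>g D. g \<in> carrier_mat m m \<Longrightarrow> det g \<noteq> 0 \<Longrightarrow> D \<in> L \<Longrightarrow> f (g * R * D) = 0"
    and "A \<in> carrier_mat m N"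
  shows "f A = 0"
  using assms unfolding orbit_generic_def by blast

lemma mat_inverse_if_det_nonzero:
  fixes g :: "'a::field mat"
  assumes "g \<in> carrier_mat n n" "det g \<noteq> 0"
  obtains g' where "g' \<in> carrier_mat n n" "det g' \<noteq> 0" "g' * g = 1\<^sub>m n" "g * g' = 1\<^sub>m n"
proof -
  have "g \<in> Units (ring_mat TYPE('a) n ())" using assms by (rule det_non_zero_imp_unit)
  then obtain g' where g': "g' \<in> carrier_mat n n" "g' * g = 1\<^sub>m n" "g * g' = 1\<^sub>m n"
    by (auto simp: Units_def ring_mat_simps)
  moreover have "det g' * det g = 1"
    using g' assms by (metis det_mult det_one)
  ultimately show ?thesis using that by force
qed

definition left_cols :: "nat \<Rightarrow> 'a mat \<Rightarrow> 'a mat" where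
  "left_cols m A = mat (dim_row A) m (\<lambda>(i, j). A $$ (i, j))"

definition right_cols :: "nat \<Rightarrow> 'a mat \<Rightarrow> 'a mat" where
  "right_cols m A = mat (dim_row A) (dim_col A - m) (\<lambda>(i, j). A $$ (i, m + j))"

definition upper_rows :: "nat \<Rightarrow> 'a mat \<Rightarrow> 'a mat" where
  "upper_rows m A = mat m (dim_col A) (\<lambda>(i, j). A $$ (i, j))"

definition lower_rows :: "nat \<Rightarrow> 'a mat \<Rightarrow> 'a mat" where
  "lower_rows m A = mat (dim_row A - m) (dim_col A) (\<lambda>(i, j). A $$ (m + i, j))"

lemma cols_rows_carrier [simp]:
  "A \<in> carrier_mat r (m + n) \<Longrightarrow> left_cols m A \<in> carrier_mat r m"
  "A \<in> carrier_mat r (m + n) \<Longrightarrow> right_cols m A \<in> carrier_mat r n"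
  "K \<in> carrier_mat (m + n) c \<Longrightarrow> upper_rows m K \<in> carrier_mat m c"
  "K \<in> carrier_mat (m + n) c \<Longrightarrow> lower_rows m K \<in> carrier_mat n c"
  by (auto simp: left_cols_def right_cols_def upper_rows_def lower_rows_def)

lemma mult_split_cols_rows:
  fixes A :: "'a::comm_ring_1 mat"
  assumes A: "A \<in> carrier_mat r (m + n)" and K: "K \<in> carrier_mat (m + n) c"
  shows "A * K = left_cols m A * upper_rows m K + right_cols m A * lower_rows m K"
proof (rule eq_matI)
  fix i j
  assume "i < dim_row (left_cols m A * upper_rows m K + right_cols m A * lower_rows m K)"
    "j < dim_col (left_cols m A * upper_rows m K + right_cols m A * lower_rows m K)"
  then have ij: "i < r" "j < c" using A K by (auto simp: right_cols_def lower_rows_def)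
  have "(A * K) $$ (i, j) = (\<Sum>k = 0..<m + n. A $$ (i, k) * K $$ (k, j))"
    using A K ij by (auto simp: scalar_prod_def)
  also have "\<dots> = (\<Sum>k = 0..<m. A $$ (i, k) * K $$ (k, j)) +
      (\<Sum>k = m..<m + n. A $$ (i, k) * K $$ (k, j))"
    by (rule sum.atLeastLessThan_concat[symmetric]) auto
  also have "(\<Sum>k = m..<m + n. A $$ (i, k) * K $$ (k, j)) =
      (\<Sum>k = 0..<n. A $$ (i, m + k) * K $$ (m + k, j))"
    using sum.shift_bounds_nat_ivl[of "\<lambda>k. A $$ (i, k) * K $$ (k, j)" 0 m n]
    by (simp add: add.commute)
  finally show "(A * K) $$ (i, j) =
      (left_cols m A * upper_rows m K + right_cols m A * lower_rows m K) $$ (i, j)"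
    using A K ij
    by (auto simp: scalar_prod_def left_cols_def right_cols_def upper_rows_def lower_rows_def)
qed (use A K in \<open>auto simp: right_cols_def lower_rows_def\<close>)

lemma eq_mat_if_rows_eq:
  assumes K: "K \<in> carrier_mat (m + n) c" and K': "K' \<in> carrier_mat (m + n) c"
    and u: "upper_rows m K = upper_rows m K'" and l: "lower_rows m K = lower_rows m K'"
  shows "K = K'"
proof (rule eq_matI)
  fix i j assume "i < dim_row K'" "j < dim_col K'"
  then have ij: "i < m + n" "j < c" using K' by auto
  show "K $$ (i, j) = K' $$ (i, j)"
  proof (cases "i < m")
    case True
    then show ?thesis using arg_cong[OF u, of "\<lambda>X. X $$ (i, j)"] ij K K'
      by (auto simp: upper_rows_def)
  next
    case False
    then show ?thesis using arg_cong[OF l, of "\<lambda>X. X $$ (i - m, j)"] ij K K'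
      by (auto simp: lower_rows_def)
  qed
qed (use K K' in auto)

lemma rows_mult:
  fixes K :: "'a::comm_ring_1 mat"
  assumes K: "K \<in> carrier_mat (m + n) c" and C: "C \<in> carrier_mat c d"
  shows "upper_rows m (K * C) = upper_rows m K * C"
    and "lower_rows m (K * C) = lower_rows m K * C"
  using assms by (auto intro!: eq_matI simp: upper_rows_def lower_rows_def scalar_prod_def)

text \<open>Write \<open>A = [T | S]\<close> with \<open>T\<close> square. If \<open>T\<close> is invertible, the columns of the block matrix with upper part \<open>- T\<inverse> S\<close> and lower
  part the identity form a basis of the kernel of \<open>A\<close>. Multiplication by \<open>det T\<close> clears the
  denominators, so that the kernel basis is a polynomial function of \<open>A\<close>.\<close>

definition kernel_mat :: "nat \<Rightarrow> nat \<Rightarrow> 'a::comm_ring_1 mat \<Rightarrow> 'a mat" where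
  "kernel_mat m n A = mat (m + n) n (\<lambda>(i, j).
     if i < m then - (adj_mat (left_cols m A) * right_cols m A) $$ (i, j)
     else if i - m = j then det (left_cols m A) else 0)"

lemma kernel_mat_carrier [simp]: "kernel_mat m n A \<in> carrier_mat (m + n) n"
  by (simp add: kernel_mat_def)

lemma rows_kernel_mat:
  fixes A :: "'a::comm_ring_1 mat"
  assumes A: "A \<in> carrier_mat m (m + n)"
  shows "upper_rows m (kernel_mat m n A) = - (adj_mat (left_cols m A) * right_cols m A)"
    and "lower_rows m (kernel_mat m n A) = det (left_cols m A) \<cdot>\<^sub>m 1\<^sub>m n"
proof -
  define P where "P = adj_mat (left_cols m A) * right_cols m A"
  have "P \<in> carrier_mat m n" unfolding P_def
    using A by (intro mult_carrier_mat[of _ m m] adj_mat) auto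
  then show "upper_rows m (kernel_mat m n A) = - (adj_mat (left_cols m A) * right_cols m A)"
    unfolding kernel_mat_def P_def[symmetric] upper_rows_def by (intro eq_matI) auto
  show "lower_rows m (kernel_mat m n A) = det (left_cols m A) \<cdot>\<^sub>m 1\<^sub>m n"
    unfolding kernel_mat_def P_def[symmetric] lower_rows_def by (intro eq_matI) auto
qed

lemma mult_kernel_mat:
  fixes A :: "'a::comm_ring_1 mat"
  assumes A: "A \<in> carrier_mat m (m + n)"
  shows "A * kernel_mat m n A = 0\<^sub>m m n"
proof -
  define T S where "T = left_cols m A" and "S = right_cols m A"
  have T: "T \<in> carrier_mat m m" and S: "S \<in> carrier_mat m n" using A by (auto simp: T_def S_def)
  have "T * (- (adj_mat T * S)) = - (T * adj_mat T * S)"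
    using adj_mat(1)[OF T] T S by (simp add: assoc_mult_mat[of _ m m _ m _ n])
  also have "\<dots> = - (det T \<cdot>\<^sub>m S)"
    using adj_mat(2)[OF T] S by (simp add: mult_smult_assoc_mat[OF one_carrier_mat])
  moreover have "S * (det T \<cdot>\<^sub>m 1\<^sub>m n) = det T \<cdot>\<^sub>m S"
    using S by (simp add: mult_smult_distrib[OF _ one_carrier_mat])
  ultimately have "A * kernel_mat m n A = - (det T \<cdot>\<^sub>m S) + det T \<cdot>\<^sub>m S"
    using mult_split_cols_rows[OF A kernel_mat_carrier] rows_kernel_mat[OF A]
    by (simp add: T_def S_def)
  also have "\<dots> = 0\<^sub>m m n"
    using S by (intro eq_matI) auto
  finally show ?thesis .
qed

text \<open>If \<open>T\<close> is invertible, a vector in the kernel of \<open>A\<close> is determined by its lower entries, and there the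
  kernel matrix is a nonzero multiple of the identity. So its columns span the kernel.\<close>

lemma kernel_mat_factor:
  fixes A :: "'a::field mat"
  assumes A: "A \<in> carrier_mat m (m + n)" and detT: "det (left_cols m A) \<noteq> 0"
    and W: "W \<in> carrier_mat (m + n) c" and AW: "A * W = 0\<^sub>m m c"
  obtains C where "C \<in> carrier_mat n c" "W = kernel_mat m n A * C"
proof
  define T S where "T = left_cols m A" and "S = right_cols m A"
  define W1 W2 where "W1 = upper_rows m W" and "W2 = lower_rows m W"
  define d where "d = det T"
  define C where "C = inverse d \<cdot>\<^sub>m W2"
  have T: "T \<in> carrier_mat m m" and S: "S \<in> carrier_mat m n"
    and W1: "W1 \<in> carrier_mat m c" and W2: "W2 \<in> carrier_mat n c"
    using A W by (auto simp: T_def S_def W1_def W2_def)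
  note adj = adj_mat[OF T]
  have d: "d \<noteq> 0" using detT by (simp add: d_def T_def)
  show C: "C \<in> carrier_mat n c" using W2 by (simp add: C_def)
  have SW: "S * W2 \<in> carrier_mat m c" and TW: "T * W1 \<in> carrier_mat m c" using S T W1 W2 by auto
  have "T * W1 + S * W2 = 0\<^sub>m m c"
    using mult_split_cols_rows[OF A W] AW by (simp add: T_def S_def W1_def W2_def)
  then have "adj_mat T * (T * W1) + adj_mat T * (S * W2) = 0\<^sub>m m c"
    using mult_add_distrib_mat[OF adj(1) TW SW] adj(1) by simp
  moreover have "adj_mat T * (T * W1) = d \<cdot>\<^sub>m W1"
    using assoc_mult_mat[OF adj(1) T W1] adj(3) mult_smult_assoc_mat[OF one_carrier_mat W1] W1
    by (simp add: d_def)
  moreover have "adj_mat T * (S * W2) = adj_mat T * S * W2"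
    using assoc_mult_mat[OF adj(1) S W2] by simp
  ultimately have sum0: "d \<cdot>\<^sub>m W1 + adj_mat T * S * W2 = 0\<^sub>m m c" by simp
  define P where "P = adj_mat T * S"
  have P: "P \<in> carrier_mat m n" using adj(1) S by (simp add: P_def)
  define Q where "Q = P * W2"
  have Q: "Q \<in> carrier_mat m c" using P W2 by (simp add: Q_def)
  have W1_eq: "W1 = - (inverse d \<cdot>\<^sub>m Q)"
  proof (rule eq_matI)
    fix i j assume "i < dim_row (- (inverse d \<cdot>\<^sub>m Q))" "j < dim_col (- (inverse d \<cdot>\<^sub>m Q))"
    then have ij: "i < m" "j < c" using Q by auto
    have "d * W1 $$ (i, j) + Q $$ (i, j) = 0"
      using arg_cong[OF sum0, of "\<lambda>X. X $$ (i, j)"] ij W1 Q by (simp add: P_def[symmetric] Q_def[symmetric])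
    then have "d * W1 $$ (i, j) = - Q $$ (i, j)" by (simp add: eq_neg_iff_add_eq_0)
    then show "W1 $$ (i, j) = (- (inverse d \<cdot>\<^sub>m Q)) $$ (i, j)"
      using d ij Q by (simp add: field_simps)
  qed (use W1 Q in auto)
  have "upper_rows m (kernel_mat m n A * C) = - P * C"
    using rows_mult(1)[OF kernel_mat_carrier C] rows_kernel_mat(1)[OF A]
    by (simp add: P_def T_def S_def)
  also have "\<dots> = - (inverse d \<cdot>\<^sub>m Q)"
    using P W2 by (simp add: C_def Q_def mult_smult_distrib[OF P W2])
  finally have u: "upper_rows m W = upper_rows m (kernel_mat m n A * C)"
    using W1_eq by (simp add: W1_def)
  have "lower_rows m (kernel_mat m n A * C) = d \<cdot>\<^sub>m 1\<^sub>m n * C"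
    using rows_mult(2)[OF kernel_mat_carrier C] rows_kernel_mat(2)[OF A]
    by (simp add: d_def T_def)
  also have "\<dots> = d \<cdot>\<^sub>m C" using C by (simp add: mult_smult_assoc_mat[OF one_carrier_mat])
  also have "\<dots> = W2" using d W2 by (intro eq_matI) (auto simp: C_def)
  finally have l: "lower_rows m W = lower_rows m (kernel_mat m n A * C)" by (simp add: W2_def)
  show "W = kernel_mat m n A * C"
    by (rule eq_mat_if_rows_eq[OF W mult_carrier_mat[OF kernel_mat_carrier C] u l])
qed


text \<open>Taking kernels turns the right action of \<open>D\<close> into that of the transposed inverse of \<open>D\<close>, so the group of
  column operations has to be stable under transposition.\<close>

locale transpose_stable_group =
  fixes L :: "'a::field mat set" and N :: nat
  assumes L_carrier: "D \<in> L \<Longrightarrow> D \<in> carrier_mat N N"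
    and L_mult: "D \<in> L \<Longrightarrow> E \<in> L \<Longrightarrow> D * E \<in> L"
    and L_transpose: "D \<in> L \<Longrightarrow> D\<^sup>T \<in> L"
    and L_inverse: "D \<in> L \<Longrightarrow> \<exists>E\<in>L. E * D = 1\<^sub>m N \<and> D * E = 1\<^sub>m N"
begin

text \<open>Density depends only on the orbit, so its base point may be moved to one with an invertible left
  block.\<close>

lemma orbit_generic_change_base:
  assumes R: "orbit_generic L m N R"
    and g0: "g0 \<in> carrier_mat m m" "det g0 \<noteq> 0" and D0: "D0 \<in> L"
  shows "orbit_generic L m N (g0 * R * D0)"
proof -
  have Rc: "R \<in> carrier_mat m N" using R by (simp add: orbit_generic_def)
  obtain h where h: "h \<in> carrier_mat m m" "det h \<noteq> 0" "h * g0 = 1\<^sub>m m"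
    using mat_inverse_if_det_nonzero[OF g0] by metis
  obtain E where E: "E \<in> L" "D0 * E = 1\<^sub>m N" using L_inverse[OF D0] by blast
  note D0c = L_carrier[OF D0] and Ec = L_carrier[OF E(1)]
  have "f A = 0" if f: "mat_poly m N f" and A: "A \<in> carrier_mat m N"
    and van: "\<forall>g\<in>carrier_mat m m. \<forall>D\<in>L. det g \<noteq> 0 \<longrightarrow> f (g * (g0 * R * D0) * D) = 0" for f A
  proof -
    have "f (g * R * D) = 0" if g: "g \<in> carrier_mat m m" "det g \<noteq> 0" and D: "D \<in> L" for g D
    proof -
      note Dc = L_carrier[OF D]
      have "(g * h) * (g0 * R * D0) * (E * D) = g * (h * g0) * R * (D0 * E) * D"
        using g(1) h(1) g0(1) Rc D0c Ec Dc
        by (simp add: assoc_mult_mat[of _ m m _ m _ N] assoc_mult_mat[of _ m m _ m _ m]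
            assoc_mult_mat[of _ m m _ N _ N] assoc_mult_mat[of _ m N _ N _ N]
            assoc_mult_mat[of _ N N _ N _ N])
      also have "\<dots> = g * R * D"
        using h(3) E(2) g(1) Rc by simp
      finally have "f (g * R * D) = f ((g * h) * (g0 * R * D0) * (E * D))" by simp
      also have "\<dots> = 0"
        using van g h L_mult[OF E(1) D] by (auto simp: det_mult)
      finally show ?thesis .
    qed
    then show ?thesis using R f A by (auto simp: orbit_generic_def)
  qed
  then show ?thesis using g0 Rc D0c by (auto simp: orbit_generic_def)
qed

text \<open>Matrices in one orbit have kernels in one orbit: \<open>g A\<^sub>0 D K = 0\<close> says that \<open>D K\<close> lies in the kernel
  of \<open>A\<^sub>0\<close>.\<close>

lemma kernel_mat_orbit:
  assumes A0: "A0 \<in> carrier_mat m N" and N: "N = m + n"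
    and g: "g \<in> carrier_mat m m" "det g \<noteq> 0" and D: "D \<in> L"
    and T0: "det (left_cols m A0) \<noteq> 0" and T: "det (left_cols m (g * A0 * D)) \<noteq> 0"
  obtains C E where "C \<in> carrier_mat n n" "det C \<noteq> 0" "E \<in> L"
    "(kernel_mat m n (g * A0 * D))\<^sup>T = C * (kernel_mat m n A0)\<^sup>T * E"
proof -
  define K K0 where "K = kernel_mat m n (g * A0 * D)" and "K0 = kernel_mat m n A0"
  have K: "K \<in> carrier_mat N n" and K0: "K0 \<in> carrier_mat N n" by (auto simp: K_def K0_def N)
  note Dc = L_carrier[OF D]
  obtain h where h: "h \<in> carrier_mat m m" "det h \<noteq> 0" "h * g = 1\<^sub>m m"
    using mat_inverse_if_det_nonzero[OF g] by metis
  obtain E where E: "E \<in> L" "E * D = 1\<^sub>m N" using L_inverse[OF D] by blast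
  note Ec = L_carrier[OF E(1)]
  have A: "g * A0 * D \<in> carrier_mat m (m + n)" using g A0 Dc N by auto
  have "A0 * (D * K) = h * g * (A0 * (D * K))" using h(3) A0 Dc K by simp
  also have "\<dots> = h * (g * A0 * D * K)"
    using h(1) g(1) A0 Dc K
    by (simp add: assoc_mult_mat[of _ m m _ m _ n] assoc_mult_mat[of _ m m _ N _ N]
          assoc_mult_mat[of _ m m _ N _ n] assoc_mult_mat[of _ m N _ N _ n])
  also have "\<dots> = 0\<^sub>m m n" using mult_kernel_mat[OF A] h by (simp add: K_def)
  finally have 0: "A0 * (D * K) = 0\<^sub>m m n" .
  have DK: "D * K \<in> carrier_mat (m + n) n" and A0': "A0 \<in> carrier_mat m (m + n)"
    using Dc K A0 N by auto
  obtain C where C: "C \<in> carrier_mat n n" "D * K = K0 * C"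
    using kernel_mat_factor[OF A0' T0 DK 0] by (auto simp: K0_def)
  have "K = E * D * K" using E(2) K by simp
  also have "\<dots> = E * (K0 * C)" using Ec Dc K C(2) by (simp add: assoc_mult_mat[of _ N N _ N _ n])
  also have "\<dots> = E * K0 * C" using Ec K0 C by (simp add: assoc_mult_mat[of _ N N _ n _ n])
  finally have K_eq: "K = E * K0 * C" .
  have EK0: "E * K0 \<in> carrier_mat (m + n) n" using Ec K0 N by auto
  \<comment> \<open>The lower block of the kernel matrix is a nonzero multiple of the identity, so the
    factor \<open>C\<close> has no kernel.\<close>
  have "det (left_cols m (g * A0 * D)) \<cdot>\<^sub>m 1\<^sub>m n = lower_rows m (E * K0) * C"
    using rows_kernel_mat(2)[OF A] rows_mult(2)[OF EK0 C(1)] K_eq by (simp add: K_def)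
  then have "det (det (left_cols m (g * A0 * D)) \<cdot>\<^sub>m 1\<^sub>m n) = det (lower_rows m (E * K0)) * det C"
    using EK0 C(1) by (simp add: det_mult[of _ n])
  then have detC: "det C \<noteq> 0" using T by auto
  have "K\<^sup>T = C\<^sup>T * (E * K0)\<^sup>T" using K_eq transpose_mult[OF _ C(1)] EK0 by simp
  also have "\<dots> = C\<^sup>T * (K0\<^sup>T * E\<^sup>T)" using transpose_mult[OF Ec K0] by simp
  also have "\<dots> = C\<^sup>T * K0\<^sup>T * E\<^sup>T"
    using C(1) K0 Ec by (simp add: assoc_mult_mat[of _ n n _ N _ N])
  finally show ?thesis
    using that[of "C\<^sup>T" "E\<^sup>T"] C(1) detC L_transpose[OF E(1)]
    by (simp add: det_transpose K_def K0_def)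
qed

text \<open>Let \<open>K(A)\<close> be the kernel matrix of \<open>A\<close>. A polynomial \<open>f\<close> on \<open>n \<times> N\<close> matrices that vanishes on the orbit of a transposed
  kernel matrix pulls back to a polynomial on \<open>m \<times> N\<close> matrices, namely \<open>f (g K(A)\<^sup>T)\<close>, which vanishes
  on the dense orbit wherever the left block of \<open>A\<close> is invertible. Hence the pullback is zero for
  every \<open>g\<close>. Every \<open>n \<times> N\<close> matrix with invertible right block has the form \<open>g K(A)\<^sup>T\<close>, so \<open>f = 0\<close>.\<close>

theorem orbit_generic_castling:
  assumes inf: "infinite (UNIV :: 'a set)"
    and N: "N = m + n" and R: "orbit_generic L m N R"
  shows "\<exists>Q. orbit_generic L n N Q"
proof -
  have poly_left: "poly_map m N m m (left_cols m :: 'a mat \<Rightarrow> _)"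
  proof (rule poly_mapI)
    fix i j assume ij: "i < m" "j < m"
    then show "mat_poly m N (\<lambda>A :: 'a mat. left_cols m A $$ (i, j))"
      by (intro mat_poly.cong[OF mat_poly.entry[of i m j N]]) (auto simp: N left_cols_def)
  qed (simp add: N)
  have poly_right: "poly_map m N m n (right_cols m :: 'a mat \<Rightarrow> _)"
  proof (rule poly_mapI)
    fix i j assume ij: "i < m" "j < n"
    then show "mat_poly m N (\<lambda>A :: 'a mat. right_cols m A $$ (i, j))"
      by (intro mat_poly.cong[OF mat_poly.entry[of i m "m + j" N]]) (auto simp: N right_cols_def)
  qed (simp add: N)
  have poly_P: "poly_map m N m n (\<lambda>A :: 'a mat. adj_mat (left_cols m A) * right_cols m A)"
    by (rule poly_map_mult[OF poly_map_adj_mat[OF poly_left] poly_right])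
  have poly_detT: "mat_poly m N (\<lambda>A :: 'a mat. det (left_cols m A))"
    by (rule mat_poly_det[OF poly_left])
  have poly_kernel: "poly_map m N N n (kernel_mat m n :: 'a mat \<Rightarrow> _)"
    unfolding kernel_mat_def N
  proof (rule poly_map_mat)
    fix i j assume ij: "i < m + n" "j < n"
    have "mat_poly m N (\<lambda>A :: 'a mat. - 1 * (adj_mat (left_cols m A) * right_cols m A) $$ (i, j))"
      if "i < m"
      using that ij by (intro mat_poly.mult mat_poly.const poly_map_entry[OF poly_P])
    then show "mat_poly m (m + n) (\<lambda>A :: 'a mat.
        if i < m then - (adj_mat (left_cols m A) * right_cols m A) $$ (i, j)
        else if i - m = j then det (left_cols m A) else 0)"
      using poly_detT mat_poly.const[of m N 0] by (cases "i < m"; cases "i - m = j") (simp_all add: N)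
  qed
  have poly_detR: "mat_poly n N (\<lambda>Z :: 'a mat. det (right_cols m Z))"
  proof (rule mat_poly_det[of _ _ n], rule poly_mapI)
    fix i j assume ij: "i < n" "j < n"
    then show "mat_poly n N (\<lambda>A :: 'a mat. right_cols m A $$ (i, j))"
      by (intro mat_poly.cong[OF mat_poly.entry[of i n "m + j" N]]) (auto simp: N right_cols_def)
  qed (simp add: N)
  define I_left :: "'a mat \<Rightarrow> 'a mat"
    where "I_left = (\<lambda>S. mat m N (\<lambda>(i, j). if j < m then 1\<^sub>m m $$ (i, j) else S $$ (i, j - m)))"
  have I_left: "I_left S \<in> carrier_mat m N" "left_cols m (I_left S) = 1\<^sub>m m"
    "S \<in> carrier_mat m n \<Longrightarrow> right_cols m (I_left S) = S" for S
    by (auto simp: I_left_def N left_cols_def right_cols_def intro!: eq_matI)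
  obtain g0 D0 where g0: "g0 \<in> carrier_mat m m" "det g0 \<noteq> 0" "D0 \<in> L"
    and T0: "det (left_cols m (g0 * R * D0)) \<noteq> 0"
  proof -
    have "det (left_cols m (I_left (0\<^sub>m m n))) \<noteq> (0 :: 'a)" by (simp add: I_left)
    then show ?thesis
      using R poly_detT I_left(1)[of "0\<^sub>m m n"] that unfolding orbit_generic_def by blast
  qed
  define A0 where "A0 = g0 * R * D0"
  have A0_gen: "orbit_generic L m N A0"
    unfolding A0_def by (rule orbit_generic_change_base[OF R g0])
  then have A0: "A0 \<in> carrier_mat m N" by (simp add: orbit_generic_def)
  define Q where "Q = (kernel_mat m n A0)\<^sup>T"
  have "orbit_generic L n N Q"
    unfolding orbit_generic_def
  proof (intro conjI allI impI ballI)
    show "Q \<in> carrier_mat n N" by (simp add: Q_def N)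
    fix f :: "'a mat \<Rightarrow> 'a" and Z :: "'a mat"
    assume f: "mat_poly n N f" and Z: "Z \<in> carrier_mat n N"
      and van: "\<forall>g\<in>carrier_mat n n. \<forall>D\<in>L. det g \<noteq> 0 \<longrightarrow> f (g * Q * D) = 0"
    \<comment> \<open>The factor \<open>det (left_cols m A)\<close> makes the pullback vanish also where \<open>K(A)\<close> degenerates.\<close>
    have vanish_kernel: "f (g * (kernel_mat m n A)\<^sup>T) * det (left_cols m A) = 0"
      if g: "g \<in> carrier_mat n n" "det g \<noteq> 0" and A: "A \<in> carrier_mat m N" for g A
    proof -
      have poly: "mat_poly m N (\<lambda>A. f (g * (kernel_mat m n A)\<^sup>T) * det (left_cols m A))"
        by (intro mat_poly.mult poly_detT mat_poly_compose[OF f] poly_map_mult[of _ _ _ n]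
              poly_map_const poly_map_transpose poly_kernel g)
      have "f (g * (kernel_mat m n (h * A0 * D))\<^sup>T) * det (left_cols m (h * A0 * D)) = 0"
        if h: "h \<in> carrier_mat m m" "det h \<noteq> 0" and D: "D \<in> L" for h D
      proof (cases "det (left_cols m (h * A0 * D)) = 0")
        case False
        obtain C E where CE: "C \<in> carrier_mat n n" "det C \<noteq> 0" "E \<in> L"
          "(kernel_mat m n (h * A0 * D))\<^sup>T = C * Q * E"
          unfolding Q_def
          using kernel_mat_orbit[OF A0 N h D T0[folded A0_def] False] by metis
        have "g * (C * Q * E) = g * C * Q * E"
          using g CE(1) L_carrier[OF CE(3)]
          by (simp add: Q_def N assoc_mult_mat[of _ n n _ n _ "m + n"]
              assoc_mult_mat[of _ n n _ "m + n" _ "m + n"])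
        then show ?thesis
          using van CE g by (simp add: det_mult)
      qed simp
      then show ?thesis using A by (rule orbit_genericD[OF A0_gen poly])
    qed
    have "f X * det (right_cols m X) = 0" if X: "X \<in> carrier_mat n N" for X
    proof (cases "det (right_cols m X) = 0")
      case False
      have Rc: "right_cols m X \<in> carrier_mat n n" and Lc: "left_cols m X \<in> carrier_mat n m"
        using X N by auto
      obtain h where h: "h \<in> carrier_mat n n" "right_cols m X * h = 1\<^sub>m n"
        using mat_inverse_if_det_nonzero[OF Rc False] by metis
      \<comment> \<open>The row operation \<open>h\<close> brings \<open>X\<close> to the form \<open>[- S\<^sup>T | 1]\<close>, the transposed kernel matrix of
        \<open>[1 | S]\<close>.\<close>
      define S where "S = - (h * left_cols m X)\<^sup>T"
      have S: "S \<in> carrier_mat m n" using h Lc by (simp add: S_def)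
      define A where "A = I_left S"
      have A: "A \<in> carrier_mat m (m + n)" using I_left(1) by (simp add: A_def N)
      have adj1: "adj_mat (1\<^sub>m m :: 'a mat) = 1\<^sub>m m"
      proof -
        have "adj_mat (1\<^sub>m m :: 'a mat) = 1\<^sub>m m * adj_mat (1\<^sub>m m)"
          by (rule left_mult_one_mat[symmetric], rule adj_mat(1)) simp
        also have "\<dots> = 1 \<cdot>\<^sub>m 1\<^sub>m m" using adj_mat(2)[OF one_carrier_mat, of m] by simp
        also have "\<dots> = 1\<^sub>m m" by (rule eq_matI) auto
        finally show ?thesis .
      qed
      have upper: "upper_rows m (kernel_mat m n A) = - S"
        using rows_kernel_mat(1)[OF A] S by (simp add: A_def I_left adj1)
      have lower: "lower_rows m (kernel_mat m n A) = 1\<^sub>m n"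
        using rows_kernel_mat(2)[OF A] by (simp add: A_def I_left det_one) (auto intro: eq_matI)
      have "kernel_mat m n A * (right_cols m X)\<^sup>T = X\<^sup>T"
      proof (rule eq_mat_if_rows_eq)
        have "upper_rows m (kernel_mat m n A * (right_cols m X)\<^sup>T) = - S * (right_cols m X)\<^sup>T"
          using rows_mult(1)[OF kernel_mat_carrier, of "(right_cols m X)\<^sup>T"] Rc upper by simp
        also have "- S = (h * left_cols m X)\<^sup>T" using h Lc by (auto simp: S_def intro!: eq_matI)
        also have "(h * left_cols m X)\<^sup>T * (right_cols m X)\<^sup>T = (right_cols m X * (h * left_cols m X))\<^sup>T"
          by (rule transpose_mult[symmetric, OF Rc]) (use h Lc in auto)
        also have "right_cols m X * (h * left_cols m X) = left_cols m X"
          using assoc_mult_mat[OF Rc h(1) Lc, symmetric] h Lc by simp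
        finally show "upper_rows m (kernel_mat m n A * (right_cols m X)\<^sup>T) = upper_rows m X\<^sup>T"
          using X by (auto simp: upper_rows_def left_cols_def N)
        have "lower_rows m (kernel_mat m n A * (right_cols m X)\<^sup>T) = (right_cols m X)\<^sup>T"
          using rows_mult(2)[OF kernel_mat_carrier, of "(right_cols m X)\<^sup>T"] Rc lower by simp
        then show "lower_rows m (kernel_mat m n A * (right_cols m X)\<^sup>T) = lower_rows m X\<^sup>T"
          using X by (auto simp: lower_rows_def right_cols_def N)
      qed (use X N Rc in \<open>auto intro: mult_carrier_mat[OF kernel_mat_carrier]\<close>)
      then have "X = (kernel_mat m n A * (right_cols m X)\<^sup>T)\<^sup>T" by simp
      also have "\<dots> = right_cols m X * (kernel_mat m n A)\<^sup>T"
        using transpose_mult[OF kernel_mat_carrier, of "(right_cols m X)\<^sup>T"] Rc by simp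
      finally have "f X = f (right_cols m X * (kernel_mat m n A)\<^sup>T)" by simp
      moreover have "det (left_cols m A) = 1" by (simp add: A_def I_left det_one)
      ultimately show ?thesis
        using vanish_kernel[OF Rc False, of A] A N by simp
    qed simp
    moreover have "\<exists>B\<in>carrier_mat n N. det (right_cols m B) \<noteq> (0 :: 'a)"
    proof
      let ?B = "mat n N (\<lambda>(i, j). if j = m + i then 1 else 0 :: 'a)"
      have "right_cols m ?B = 1\<^sub>m n" by (auto simp: right_cols_def N intro!: eq_matI)
      then show "det (right_cols m ?B) \<noteq> 0" by simp
    qed simp
    ultimately show "f Z = 0"
      using mat_poly_eq_0_if_mult_eq_0[OF inf f poly_detR _ _ _ Z] by blast
  qed
  then show ?thesis by blast
qed

end

section \<open>Matrices with blocks of columns\<close>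

text \<open>The columns of a matrix with \<open>sum_list ds\<close> columns are grouped into blocks of widths \<open>ds\<close>; column \<open>c\<close> of
  block \<open>i\<close> is column \<open>\<tau> (i, c)\<close>. Any bijection serves, and sums over columns become double sums without
  arithmetic on offsets.\<close>

locale column_blocks =
  fixes ds :: "nat list" and \<tau> :: "nat \<times> nat \<Rightarrow> nat"
  assumes bij: "bij_betw \<tau> (SIGMA i:{..<length ds}. {..<ds ! i}) {..<sum_list ds}"
begin

definition blk :: "nat \<Rightarrow> nat" where
  "blk j = fst (inv_into (SIGMA i:{..<length ds}. {..<ds ! i}) \<tau> j)"

definition off :: "nat \<Rightarrow> nat" where
  "off j = snd (inv_into (SIGMA i:{..<length ds}. {..<ds ! i}) \<tau> j)"

lemma blk_off:
  assumes "j < sum_list ds"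
  shows "blk j < length ds" "off j < ds ! blk j" "\<tau> (blk j, off j) = j"
proof -
  let ?S = "SIGMA i:{..<length ds}. {..<ds ! i}"
  have "inv_into ?S \<tau> j \<in> ?S" "\<tau> (inv_into ?S \<tau> j) = j"
    using bij assms by (auto simp: bij_betw_def intro!: inv_into_into f_inv_into_f simp del: mem_Sigma_iff)
  then show "blk j < length ds" "off j < ds ! blk j" "\<tau> (blk j, off j) = j"
    by (auto simp: blk_def off_def)
qed

lemma blk_off_tau:
  assumes "i < length ds" "c < ds ! i"
  shows "\<tau> (i, c) < sum_list ds" "blk (\<tau> (i, c)) = i" "off (\<tau> (i, c)) = c"
proof -
  have ic: "(i, c) \<in> (SIGMA i:{..<length ds}. {..<ds ! i})" using assms by simp
  then show "\<tau> (i, c) < sum_list ds" using bij by (auto simp: bij_betw_def)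
  show "blk (\<tau> (i, c)) = i" "off (\<tau> (i, c)) = c"
    using bij_betw_inv_into_left[OF bij ic] by (auto simp: blk_def off_def)
qed

lemma sum_columns:
  "(\<Sum>j = 0..<sum_list ds. F j) = (\<Sum>i<length ds. \<Sum>c<ds ! i. F (\<tau> (i, c)))"
proof -
  have "(\<Sum>j = 0..<sum_list ds. F j) = (\<Sum>x\<in>(SIGMA i:{..<length ds}. {..<ds ! i}). F (\<tau> x))"
    using sum.reindex_bij_betw[OF bij, of F] by (simp add: atLeast0LessThan)
  also have "\<dots> = (\<Sum>i<length ds. \<Sum>c<ds ! i. F (\<tau> (i, c)))"
    by (subst sum.Sigma) auto
  finally show ?thesis .
qed

definition block :: "nat \<Rightarrow> 'a mat \<Rightarrow> 'a mat" where
  "block i Q = mat (dim_row Q) (ds ! i) (\<lambda>(r, c). Q $$ (r, \<tau> (i, c)))"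

definition join :: "nat \<Rightarrow> (nat \<Rightarrow> 'a mat) \<Rightarrow> 'a mat" where
  "join n M = mat n (sum_list ds) (\<lambda>(r, j). M (blk j) $$ (r, off j))"

definition block_diag :: "(nat \<Rightarrow> 'a::zero mat) \<Rightarrow> 'a mat" where
  "block_diag h = mat (sum_list ds) (sum_list ds)
     (\<lambda>(j, j'). if blk j = blk j' then h (blk j) $$ (off j, off j') else 0)"

lemma block_carrier [simp]: "Q \<in> carrier_mat n (sum_list ds) \<Longrightarrow> block i Q \<in> carrier_mat n (ds ! i)"
  by (auto simp: block_def)

lemma join_carrier [simp]: "join n M \<in> carrier_mat n (sum_list ds)"
  by (simp add: join_def)

lemma block_diag_carrier [simp]: "block_diag h \<in> carrier_mat (sum_list ds) (sum_list ds)"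
  by (simp add: block_diag_def)

lemma block_join: "i < length ds \<Longrightarrow> M i \<in> carrier_mat n (ds ! i) \<Longrightarrow> block i (join n M) = M i"
  by (rule eq_matI) (auto simp: block_def join_def blk_off_tau)

lemma eq_mat_if_blocks_eq:
  assumes Q: "Q \<in> carrier_mat n (sum_list ds)" and Q': "Q' \<in> carrier_mat n (sum_list ds)"
    and eq: "\<And>i. i < length ds \<Longrightarrow> block i Q = block i Q'"
  shows "Q = Q'"
proof (rule eq_matI)
  fix r j assume "r < dim_row Q'" "j < dim_col Q'"
  then have rj: "r < n" "j < sum_list ds" using Q' by auto
  note b = blk_off[OF rj(2)]
  show "Q $$ (r, j) = Q' $$ (r, j)"
    using arg_cong[OF eq[OF b(1)], of "\<lambda>X. X $$ (r, off j)"] rj b Q Q' by (simp add: block_def)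
qed (use Q Q' in auto)

lemma block_mult:
  fixes g :: "'a::comm_ring_1 mat"
  assumes "g \<in> carrier_mat k n" "Q \<in> carrier_mat n (sum_list ds)" "i < length ds"
  shows "block i (g * Q) = g * block i Q"
  using assms by (intro eq_matI) (auto simp: block_def blk_off_tau scalar_prod_def)

lemma block_mult_block_diag:
  fixes Q :: "'a::comm_ring_1 mat"
  assumes Q: "Q \<in> carrier_mat n (sum_list ds)" and i: "i < length ds"
    and h: "h i \<in> carrier_mat (ds ! i) (ds ! i)"
  shows "block i (Q * block_diag h) = block i Q * h i"
proof (rule eq_matI)
  fix r c assume "r < dim_row (block i Q * h i)" "c < dim_col (block i Q * h i)"
  then have rc: "r < n" "c < ds ! i" using Q h by (auto simp: block_def)
  have "block i (Q * block_diag h) $$ (r, c) =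
      (\<Sum>j = 0..<sum_list ds. Q $$ (r, j) * block_diag h $$ (j, \<tau> (i, c)))"
    using rc Q i by (simp add: block_def blk_off_tau scalar_prod_def block_diag_def)
  also have "\<dots> = (\<Sum>i'<length ds. \<Sum>c'<ds ! i'. Q $$ (r, \<tau> (i', c')) * block_diag h $$ (\<tau> (i', c'), \<tau> (i, c)))"
    by (rule sum_columns)
  also have "\<dots> = (\<Sum>i'<length ds. if i' = i then \<Sum>c'<ds ! i. Q $$ (r, \<tau> (i, c')) * h i $$ (c', c) else 0)"
    using i rc by (intro sum.cong) (auto simp: block_diag_def blk_off_tau intro!: sum.neutral)
  also have "\<dots> = (\<Sum>c'<ds ! i. Q $$ (r, \<tau> (i, c')) * h i $$ (c', c))"
    using i by (simp add: sum.delta)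
  also have "\<dots> = (block i Q * h i) $$ (r, c)"
    using rc Q h by (simp add: block_def scalar_prod_def atLeast0LessThan)
  finally show "block i (Q * block_diag h) $$ (r, c) = (block i Q * h i) $$ (r, c)" .
qed (use Q h in \<open>auto simp: block_def\<close>)

lemma block_diag_mult:
  fixes h h' :: "nat \<Rightarrow> 'a::comm_ring_1 mat"
  assumes h: "\<And>i. i < length ds \<Longrightarrow> h i \<in> carrier_mat (ds ! i) (ds ! i)"
    and h': "\<And>i. i < length ds \<Longrightarrow> h' i \<in> carrier_mat (ds ! i) (ds ! i)"
  shows "block_diag h * block_diag h' = block_diag (\<lambda>i. h i * h' i)"
proof (rule eq_mat_if_blocks_eq[of _ "sum_list ds"])
  fix i assume i: "i < length ds"
  have "block i (block_diag h * block_diag h') = block i (block_diag h) * h' i"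
    using block_mult_block_diag[of "block_diag h" "sum_list ds" i h'] i h' by simp
  also have "\<dots> = block i (block_diag (\<lambda>i. h i * h' i))"
  proof (rule eq_matI)
    fix r c assume "r < dim_row (block i (block_diag (\<lambda>i. h i * h' i)))"
      "c < dim_col (block i (block_diag (\<lambda>i. h i * h' i)))"
    then have rc: "r < sum_list ds" "c < ds ! i" by (auto simp: block_def block_diag_def)
    note b = blk_off[OF rc(1)]
    show "(block i (block_diag h) * h' i) $$ (r, c) =
        block i (block_diag (\<lambda>i. h i * h' i)) $$ (r, c)"
      using rc i b h[OF i] h'[OF i]
      by (cases "blk r = i") (auto simp: block_def block_diag_def blk_off_tau scalar_prod_def)
  qed (use h'[OF i] in \<open>auto simp: block_def block_diag_def\<close>)
  finally show "block i (block_diag h * block_diag h') = block i (block_diag (\<lambda>i. h i * h' i))" .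
qed (auto intro: mult_carrier_mat[OF block_diag_carrier])

lemma block_diag_one:
  "block_diag (\<lambda>i. 1\<^sub>m (ds ! i)) = (1\<^sub>m (sum_list ds) :: 'a::comm_ring_1 mat)"
proof (rule eq_matI)
  fix j j' assume "j < dim_row (1\<^sub>m (sum_list ds) :: 'a mat)" "j' < dim_col (1\<^sub>m (sum_list ds) :: 'a mat)"
  then have "j < sum_list ds" "j' < sum_list ds" by auto
  with blk_off[of j] blk_off[of j']
  show "block_diag (\<lambda>i. 1\<^sub>m (ds ! i)) $$ (j, j') = (1\<^sub>m (sum_list ds) :: 'a mat) $$ (j, j')"
    by (auto simp: block_diag_def)
qed (auto simp: block_diag_def)

lemma block_diag_transpose:
  fixes h :: "nat \<Rightarrow> 'a::comm_ring_1 mat"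
  assumes h: "\<And>i. i < length ds \<Longrightarrow> h i \<in> carrier_mat (ds ! i) (ds ! i)"
  shows "(block_diag h)\<^sup>T = block_diag (\<lambda>i. (h i)\<^sup>T)"
proof (rule eq_matI)
  fix j j' assume "j < dim_row (block_diag (\<lambda>i. (h i)\<^sup>T))" "j' < dim_col (block_diag (\<lambda>i. (h i)\<^sup>T))"
  then have j: "j < sum_list ds" and j': "j' < sum_list ds" by (auto simp: block_diag_def)
  show "(block_diag h)\<^sup>T $$ (j, j') = block_diag (\<lambda>i. (h i)\<^sup>T) $$ (j, j')"
  proof (cases "blk j = blk j'")
    case True
    then show ?thesis using j j' blk_off[OF j] blk_off[OF j'] h[of "blk j'"]
      by (simp add: block_diag_def)
  qed (use j j' in \<open>auto simp: block_diag_def\<close>)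
qed (auto simp: block_diag_def)

text \<open>Changes of basis in the individual subspaces.\<close>

definition GL_blocks :: "'a::field mat set" where
  "GL_blocks = {block_diag h | h. \<forall>i<length ds. h i \<in> carrier_mat (ds ! i) (ds ! i) \<and> det (h i) \<noteq> 0}"

lemma transpose_stable_group_GL_blocks:
  "transpose_stable_group (GL_blocks :: 'a::field mat set) (sum_list ds)"
proof
  fix D E :: "'a mat" assume "D \<in> GL_blocks"
  then obtain h where D: "D = block_diag h"
    and h: "\<And>i. i < length ds \<Longrightarrow> h i \<in> carrier_mat (ds ! i) (ds ! i) \<and> det (h i) \<noteq> 0"
    by (auto simp: GL_blocks_def)
  show "D \<in> carrier_mat (sum_list ds) (sum_list ds)" by (simp add: D)
  show "D\<^sup>T \<in> GL_blocks"
    unfolding GL_blocks_def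
  proof (intro CollectI exI[of _ "\<lambda>i. (h i)\<^sup>T"] conjI allI impI)
    show "D\<^sup>T = block_diag (\<lambda>i. (h i)\<^sup>T)" using h by (simp add: D block_diag_transpose)
    fix i assume i: "i < length ds"
    show "(h i)\<^sup>T \<in> carrier_mat (ds ! i) (ds ! i)" using h[OF i] by simp
    show "det (h i)\<^sup>T \<noteq> 0" using h[OF i] by (simp add: det_transpose[of _ "ds ! i"])
  qed
  show "\<exists>E\<in>GL_blocks. E * D = 1\<^sub>m (sum_list ds) \<and> D * E = 1\<^sub>m (sum_list ds)"
  proof -
    have "\<exists>k. k \<in> carrier_mat (ds ! i) (ds ! i) \<and> det k \<noteq> 0 \<and>
        k * h i = 1\<^sub>m (ds ! i) \<and> h i * k = 1\<^sub>m (ds ! i)" if "i < length ds" for i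
      using h[OF that] mat_inverse_if_det_nonzero[of "h i" "ds ! i"] by metis
    then obtain k where k: "\<And>i. i < length ds \<Longrightarrow> k i \<in> carrier_mat (ds ! i) (ds ! i) \<and>
        det (k i) \<noteq> 0 \<and> k i * h i = 1\<^sub>m (ds ! i) \<and> h i * k i = 1\<^sub>m (ds ! i)"
      by metis
    have one: "block_diag f = 1\<^sub>m (sum_list ds)"
      if "\<And>i. i < length ds \<Longrightarrow> f i = 1\<^sub>m (ds ! i)" for f :: "nat \<Rightarrow> 'a mat"
    proof -
      have "block_diag f = block_diag (\<lambda>i. 1\<^sub>m (ds ! i))"
        using that blk_off(1) by (auto simp: block_diag_def intro!: eq_matI)
      then show ?thesis by (simp add: block_diag_one)
    qed
    have "block_diag k \<in> GL_blocks" using k by (auto simp: GL_blocks_def)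
    moreover have "block_diag k * D = 1\<^sub>m (sum_list ds)" "D * block_diag k = 1\<^sub>m (sum_list ds)"
      using h k by (auto simp: D block_diag_mult intro!: one)
    ultimately show ?thesis by blast
  qed
  assume "E \<in> GL_blocks"
  then obtain k where E: "E = block_diag k"
    and k: "\<And>i. i < length ds \<Longrightarrow> k i \<in> carrier_mat (ds ! i) (ds ! i) \<and> det (k i) \<noteq> 0"
    by (auto simp: GL_blocks_def)
  show "D * E \<in> GL_blocks"
    unfolding GL_blocks_def
  proof (intro CollectI exI[of _ "\<lambda>i. h i * k i"] conjI allI impI)
    show "D * E = block_diag (\<lambda>i. h i * k i)" using h k by (simp add: D E block_diag_mult)
    fix i assume i: "i < length ds"
    show "h i * k i \<in> carrier_mat (ds ! i) (ds ! i)" using h[OF i] k[OF i] by auto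
    show "det (h i * k i) \<noteq> 0" using h[OF i] k[OF i] by (simp add: det_mult[of _ "ds ! i"])
  qed
qed

end

lemma column_blocks_exists: "\<exists>\<tau>. column_blocks ds \<tau>"
proof -
  have "card (SIGMA i:{..<length ds}. {..<ds ! i}) = card {..<sum_list ds}"
    by (simp add: sum_list_sum_nth atLeast0LessThan)
  then show ?thesis
    unfolding column_blocks_def by (intro finite_same_card_bij) auto
qed

section \<open>Subspaces as ranges of matrices\<close>

text \<open>Points of the Grassmannian are ranges of injective matrices. The lemmas of this part translate
  between these matrices and bases in the sense of abstract vector spaces.\<close>

definition full_column_rank :: "nat \<Rightarrow> nat \<Rightarrow> 'a::field mat \<Rightarrow> bool" where
  "full_column_rank n d M \<longleftrightarrow> M \<in> carrier_mat n d \<and>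
     (\<forall>v\<in>carrier_vec d. M *\<^sub>v v = 0\<^sub>v n \<longrightarrow> v = 0\<^sub>v d)"

definition mat_range :: "'a::field mat \<Rightarrow> 'a vec set" where
  "mat_range M = (\<lambda>v. M *\<^sub>v v) ` carrier_vec (dim_col M)"

lemma mat_mult_unit_vec_col:
  fixes M :: "'a::comm_ring_1 mat"
  assumes "M \<in> carrier_mat n d" "i < d"
  shows "M *\<^sub>v unit_vec d i = col M i"
  using assms by (intro eq_vecI) auto

lemma col_space_eq_mat_range:
  "M \<in> carrier_mat n d \<Longrightarrow>
     LinearCombinations.module.span class_ring (module_vec TYPE('a) n) (set (cols M)) = mat_range (M :: 'a::field mat)"
proof -
  assume M: "M \<in> carrier_mat n d"
  interpret vec_space "TYPE('a)" n .
  show ?thesis using col_space_eq[OF M] M by (auto simp: col_space_def mat_range_def)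
qed

lemma basis_matrix_if_full_column_rank:
  fixes M :: "'a::field mat"
  assumes M: "full_column_rank n d M"
  shows "mat_range M \<in> Gr d n" and "basis_matrix n (mat_range M) M"
proof -
  interpret vec_space "TYPE('a)" n .
  have Mc: "M \<in> carrier_mat n d" and inj: "\<And>v. v \<in> carrier_vec d \<Longrightarrow> M *\<^sub>v v = 0\<^sub>v n \<Longrightarrow> v = 0\<^sub>v d"
    using M by (auto simp: full_column_rank_def)
  have dist: "distinct (cols M)"
  proof (rule ccontr)
    assume "\<not> distinct (cols M)"
    then obtain i j where ij: "i < d" "j < d" "i \<noteq> j" "col M i = col M j"
      using Mc by (auto simp: distinct_conv_nth)
    define v where "v = unit_vec d i - (unit_vec d j :: 'a vec)"
    have "M *\<^sub>v v = M *\<^sub>v unit_vec d i - M *\<^sub>v unit_vec d j"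
      using Mc by (simp add: v_def mult_minus_distrib_mat_vec)
    also have "\<dots> = 0\<^sub>v n" using Mc ij by (simp add: mat_mult_unit_vec_col)
    finally have "v = 0\<^sub>v d" using inj by (simp add: v_def)
    then have "v $ i = 0" using ij by simp
    then show False using ij by (simp add: v_def)
  qed
  have ind: "lin_indpt (set (cols M))"
    using lin_depE[OF Mc _ dist] inj by metis
  have Vc: "set (cols M) \<subseteq> carrier_vec n" using Mc cols_dim[of M] by auto
  have sp: "span (set (cols M)) = mat_range M" using col_space_eq_mat_range[OF Mc] .
  have sub: "VectorSpace.subspace class_ring (mat_range M) V" using span_is_subspace[OF Vc] sp by simp
  then have submod: "submodule class_ring (mat_range M) V" by (rule is_module)
  interpret U: vectorspace class_ring "vs (mat_range M)" by (rule subspace_is_vs[OF sub])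
  have incl: "set (cols M) \<subseteq> mat_range M" using in_own_span[OF Vc] sp by simp
  have basis: "U.basis (set (cols M))"
    unfolding U.basis_def using span_li_not_depend[OF incl submod] ind sp incl by simp
  then show "basis_matrix n (mat_range M) M" using Mc dist by (simp add: basis_matrix_def)
  have "U.dim = card (set (cols M))" by (rule U.dim_basis[OF _ basis]) simp
  also have "\<dots> = d" using dist Mc by (simp add: distinct_card)
  finally show "mat_range M \<in> Gr d n" using sub by (simp add: Gr_def)
qed

lemma full_column_rank_if_basis_matrix:
  fixes M :: "'a::field mat"
  assumes U: "U \<in> Gr d n" and M: "basis_matrix n U M"
  shows "full_column_rank n d M" and "U = mat_range M"
proof -
  interpret vec_space "TYPE('a)" n .
  have sub: "VectorSpace.subspace class_ring U V" using U by (simp add: Gr_def)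
  then have submod: "submodule class_ring U V" by (rule is_module)
  interpret U: vectorspace class_ring "vs U" by (rule subspace_is_vs[OF sub])
  have dist: "distinct (cols M)" and basis: "U.basis (set (cols M))" and row: "dim_row M = n"
    using M by (auto simp: basis_matrix_def)
  have "U.dim = card (set (cols M))" by (rule U.dim_basis[OF _ basis]) simp
  then have Mc: "M \<in> carrier_mat n d" using U dist row distinct_card[OF dist] by (auto simp: Gr_def)
  have incl: "set (cols M) \<subseteq> U" using basis by (simp add: U.basis_def)
  have ind: "lin_indpt (set (cols M))" and sp: "span (set (cols M)) = U"
    using basis span_li_not_depend[OF incl submod] by (simp_all add: U.basis_def)
  show "U = mat_range M" using col_space_eq_mat_range[OF Mc] sp by simp
  show "full_column_rank n d M"
    unfolding full_column_rank_def using Mc lin_depI[OF Mc _ _ _ dist] ind by blast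
qed

text \<open>Linearly independent subsets of \<open>U\<close> have at most \<open>n\<close> elements, so a maximal one exists; it is a finite
  basis.\<close>

lemma basis_matrix_exists:
  fixes U :: "'a::field vec set"
  assumes U: "U \<in> Gr d n"
  shows "\<exists>M. basis_matrix n U M"
proof -
  interpret vec_space "TYPE('a)" n .
  have sub: "VectorSpace.subspace class_ring U V" using U by (simp add: Gr_def)
  then have submod: "submodule class_ring U V" by (rule is_module)
  then have UV: "U \<subseteq> carrier V" by (simp add: submodule_def)
  interpret U: vectorspace class_ring "vs U" by (rule subspace_is_vs[OF sub])
  have small: "finite S \<and> card S \<le> dim" if "S \<subseteq> carrier (vs U) \<and> U.lin_indpt S" for S
  proof -
    have "lin_indpt S" "S \<subseteq> carrier V" using that UV span_li_not_depend(2)[OF _ submod, of S] by auto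
    then show ?thesis using li_le_dim[of S] by simp
  qed
  have "\<exists>A. finite A \<and> maximal A (\<lambda>S. S \<subseteq> carrier (vs U) \<and> U.lin_indpt S)"
  proof (rule maximal_exists[where ?N = dim and ?B = "{}"])
    show "\<And>S. S \<subseteq> carrier (vs U) \<and> U.lin_indpt S \<Longrightarrow> finite S \<and> card S \<le> dim" by (rule small)
    show "{} \<subseteq> carrier (vs U) \<and> U.lin_indpt {}" by (auto simp: U.lin_dep_def)
  qed
  then obtain A where A: "finite A" "U.basis A" using U.max_li_is_basis by blast
  obtain xs where xs: "set xs = A" "distinct xs" using finite_distinct_list[OF A(1)] by blast
  have "set xs \<subseteq> carrier_vec n" using A(2) UV xs by (auto simp: U.basis_def)
  then have "basis_matrix n U (mat_of_cols n xs)" using xs A by (simp add: basis_matrix_def)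
  then show ?thesis by blast
qed

lemma mat_factor_if_range_subset:
  fixes M M' :: "'a::field mat"
  assumes M: "M \<in> carrier_mat n d" and M': "M' \<in> carrier_mat n d'"
    and sub: "mat_range M' \<subseteq> mat_range M"
  obtains h where "h \<in> carrier_mat d d'" "M' = M * h"
proof -
  have "\<exists>v. v \<in> carrier_vec d \<and> M *\<^sub>v v = col M' j" if j: "j < d'" for j
  proof -
    have "col M' j = M' *\<^sub>v unit_vec d' j" using M' j by (simp add: mat_mult_unit_vec_col)
    then have "col M' j \<in> mat_range M" using sub M' by (auto simp: mat_range_def)
    then show ?thesis using M by (auto simp: mat_range_def)
  qed
  then obtain v where v: "\<And>j. j < d' \<Longrightarrow> v j \<in> carrier_vec d \<and> M *\<^sub>v v j = col M' j" by metis
  define h where "h = mat_of_cols d (map v [0..<d'])"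
  have h: "h \<in> carrier_mat d d'" by (simp add: h_def mat_of_cols_carrier(1)[of d "map v [0..<d']", simplified])
  have "M' = M * h"
  proof (rule mat_col_eqI)
    fix j assume "j < dim_col (M * h)"
    then have j: "j < d'" using h by simp
    have "col (M * h) j = M *\<^sub>v col h j" using M h j by (intro eq_vecI) auto
    also have "col h j = v j" using j v[OF j] by (simp add: h_def)
    finally show "col M' j = col (M * h) j" using v[OF j] by simp
  qed (use M M' h in auto)
  then show ?thesis using that h by blast
qed

lemma mat_range_mult:
  fixes M :: "'a::field mat"
  assumes "M \<in> carrier_mat n d" "g \<in> carrier_mat k n"
  shows "mat_range (g * M) = (\<lambda>v. g *\<^sub>v v) ` mat_range M"
  using assms by (auto simp: mat_range_def image_image intro!: image_cong)

lemma mat_range_mult_invertible: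
  fixes M :: "'a::field mat"
  assumes M: "M \<in> carrier_mat n d" and h: "h \<in> carrier_mat d d" "det h \<noteq> 0"
  shows "mat_range (M * h) = mat_range M"
proof -
  obtain k where k: "k \<in> carrier_mat d d" "h * k = 1\<^sub>m d" using mat_inverse_if_det_nonzero[OF h] by metis
  have "M *\<^sub>v v = (M * h) *\<^sub>v (k *\<^sub>v v)" if "v \<in> carrier_vec d" for v
  proof -
    have "(M * h) *\<^sub>v (k *\<^sub>v v) = M *\<^sub>v ((h * k) *\<^sub>v v)"
      using M h k(1) that by simp
    then show ?thesis unfolding k(2) using that by simp
  qed
  moreover have "(M * h) *\<^sub>v v = M *\<^sub>v (h *\<^sub>v v)" if "v \<in> carrier_vec d" for v
    using M h that by simp
  ultimately show ?thesis using M h k by (force simp: mat_range_def)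
qed

lemma full_column_rank_mult_right:
  assumes M: "full_column_rank n d (M :: 'a::field mat)" and h: "h \<in> carrier_mat d d" "det h \<noteq> 0"
  shows "full_column_rank n d (M * h)"
proof -
  have Mc: "M \<in> carrier_mat n d" using M by (simp add: full_column_rank_def)
  have "v = 0\<^sub>v d" if v: "v \<in> carrier_vec d" "(M * h) *\<^sub>v v = 0\<^sub>v n" for v
  proof -
    have "M *\<^sub>v (h *\<^sub>v v) = 0\<^sub>v n" using v Mc h by simp
    then have "h *\<^sub>v v = 0\<^sub>v d" using M v h by (simp add: full_column_rank_def)
    then show ?thesis using det_0_iff_vec_prod_zero_field[OF h(1)] h(2) v by blast
  qed
  then show ?thesis using Mc h by (auto simp: full_column_rank_def)
qed

lemma full_column_rank_mult_left:
  assumes M: "full_column_rank n d (M :: 'a::field mat)" and g: "g \<in> carrier_mat n n" "det g \<noteq> 0"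
  shows "full_column_rank n d (g * M)"
proof -
  have Mc: "M \<in> carrier_mat n d" using M by (simp add: full_column_rank_def)
  have "v = 0\<^sub>v d" if v: "v \<in> carrier_vec d" "(g * M) *\<^sub>v v = 0\<^sub>v n" for v
  proof -
    have "g *\<^sub>v (M *\<^sub>v v) = 0\<^sub>v n" using v Mc g by simp
    moreover have "M *\<^sub>v v \<in> carrier_vec n" using Mc v by auto
    ultimately have "M *\<^sub>v v = 0\<^sub>v n"
      using det_0_iff_vec_prod_zero_field[OF g(1)] g(2) by blast
    then show ?thesis using M v by (simp add: full_column_rank_def)
  qed
  then show ?thesis using Mc g by (auto simp: full_column_rank_def)
qed

lemma mat_range_eqE:
  fixes M M' :: "'a::field mat"
  assumes M: "M \<in> carrier_mat n d" and M': "full_column_rank n d M'"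
    and eq: "mat_range M' = mat_range M"
  obtains h where "h \<in> carrier_mat d d" "det h \<noteq> 0" "M' = M * h"
proof -
  have M'c: "M' \<in> carrier_mat n d" using M' by (simp add: full_column_rank_def)
  obtain h where h: "h \<in> carrier_mat d d" "M' = M * h"
    using mat_factor_if_range_subset[OF M M'c] eq by auto
  have "det h \<noteq> 0"
  proof
    assume "det h = 0"
    then obtain v where v: "v \<in> carrier_vec d" "v \<noteq> 0\<^sub>v d" "h *\<^sub>v v = 0\<^sub>v d"
      using det_0_iff_vec_prod_zero_field[OF h(1)] by blast
    then have "M' *\<^sub>v v = 0\<^sub>v n" using M h by (auto intro!: eq_vecI)
    then show False using M' v by (auto simp: full_column_rank_def)
  qed
  then show ?thesis using that h by blast
qed

lemma full_column_rank_if_det_upper_rows: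
  fixes M :: "'a::field mat"
  assumes M: "M \<in> carrier_mat n d" and d: "d \<le> n" and det: "det (upper_rows d M) \<noteq> 0"
  shows "full_column_rank n d M"
proof -
  have T: "upper_rows d M \<in> carrier_mat d d" using M by (simp add: upper_rows_def)
  have "v = 0\<^sub>v d" if v: "v \<in> carrier_vec d" "M *\<^sub>v v = 0\<^sub>v n" for v
  proof -
    have "upper_rows d M *\<^sub>v v = 0\<^sub>v d"
    proof (rule eq_vecI)
      fix i assume "i < dim_vec (0\<^sub>v d :: 'a vec)"
      then have i: "i < d" by simp
      have "(M *\<^sub>v v) $ i = 0" using v(2) i d by simp
      moreover have "row (upper_rows d M) i = row M i"
        using M i d by (intro eq_vecI) (auto simp: upper_rows_def)
      ultimately show "(upper_rows d M *\<^sub>v v) $ i = 0\<^sub>v d $ i"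
        using M T i d by simp
    qed (use T in auto)
    then show ?thesis using det_0_iff_vec_prod_zero_field[OF T] det v(1) by blast
  qed
  then show ?thesis using M by (simp add: full_column_rank_def)
qed

section \<open>Orbits and closed sets in products of Grassmannians\<close>

lemma in_listset_iff:
  "xs \<in> listset As \<longleftrightarrow> length xs = length As \<and> (\<forall>i<length As. xs ! i \<in> As ! i)"
proof (induction As arbitrary: xs)
  case (Cons A As)
  then show ?case by (cases xs) (auto simp: set_Cons_def nth_Cons split: nat.splits)
qed auto

lemma in_Gr_prod_iff:
  "Us \<in> Gr_prod ds n \<longleftrightarrow> length Us = length ds \<and> (\<forall>i<length ds. Us ! i \<in> Gr (ds ! i) n)"
  by (simp add: Gr_prod_def in_listset_iff)

lemma Gr_is_range:
  assumes "U \<in> Gr d n"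
  obtains M :: "'a::field mat" where "full_column_rank n d M" "U = mat_range M"
  using assms basis_matrix_exists full_column_rank_if_basis_matrix by metis

text \<open>Subspaces are closed under scaling, so each coset acts like any of its representatives.\<close>

lemma PGL_orbit_eq:
  fixes Us :: "'a::field vec set list"
  assumes Us: "Us \<in> Gr_prod ds n"
  shows "PGL_orbit n Us = {map (\<lambda>U. (\<lambda>v. g *\<^sub>v v) ` U) Us | g. g \<in> carrier_mat n n \<and> det g \<noteq> 0}"
proof -
  let ?H = "{c \<cdot>\<^sub>m 1\<^sub>m n | c. c \<noteq> (0 :: 'a)}"
  have carrier_GL: "carrier (GL TYPE('a) n) = {g \<in> carrier_mat n n. det g \<noteq> 0}"
  proof -
    have "g \<in> Units (ring_mat TYPE('a) n ()) \<longleftrightarrow> g \<in> carrier_mat n n \<and> det g \<noteq> 0" for g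
      using det_non_zero_imp_unit[of g n "()"] unit_imp_det_non_zero[of g n "()"]
      by (auto simp: Units_def ring_mat_simps)
    then show ?thesis by (auto simp: GL_def units_of_carrier)
  qed
  have coset: "?H #>\<^bsub>GL TYPE('a) n\<^esub> g = {c \<cdot>\<^sub>m g | c. c \<noteq> 0}" if g: "g \<in> carrier_mat n n" for g
  proof -
    have "c \<cdot>\<^sub>m 1\<^sub>m n * g = c \<cdot>\<^sub>m g" for c using g by (simp add: mult_smult_assoc_mat[OF one_carrier_mat])
    then show ?thesis by (auto simp: r_coset_def GL_def units_of_mult ring_mat_simps)
  qed
  have act: "PGL_act {c \<cdot>\<^sub>m g | c. c \<noteq> 0} U = (\<lambda>v. g *\<^sub>v v) ` U"
    if g: "g \<in> carrier_mat n n" and U: "U \<in> Gr d n" for g d and U :: "'a vec set"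
  proof -
    obtain M where M: "M \<in> carrier_mat n d" "U = mat_range M"
      using Gr_is_range[OF U] by (metis full_column_rank_def)
    have smult: "c \<cdot>\<^sub>v v \<in> U" if v: "v \<in> U" for c v
    proof -
      obtain w where w: "w \<in> carrier_vec d" "v = M *\<^sub>v w" using v M by (auto simp: mat_range_def)
      then have "c \<cdot>\<^sub>v v = M *\<^sub>v (c \<cdot>\<^sub>v w)" using M by (simp add: mult_mat_vec)
      then show ?thesis using M w by (auto simp: mat_range_def)
    qed
    have U_carrier: "v \<in> carrier_vec n" if "v \<in> U" for v using that M by (auto simp: mat_range_def)
    have "(c \<cdot>\<^sub>m g) *\<^sub>v v = g *\<^sub>v (c \<cdot>\<^sub>v v)" if "v \<in> U" for c v
      using g U_carrier[OF that] by (intro eq_vecI) auto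
    then have sub: "(\<lambda>v. (c \<cdot>\<^sub>m g) *\<^sub>v v) ` U \<subseteq> (\<lambda>v. g *\<^sub>v v) ` U" for c using smult by auto
    have "1 \<cdot>\<^sub>m g = g" by (rule eq_matI) auto
    then have g_mem: "g \<in> {c \<cdot>\<^sub>m g | c. c \<noteq> 0}" by (intro CollectI exI[of _ 1]) simp
    have "(\<lambda>v. g *\<^sub>v v) ` U \<subseteq> PGL_act {c \<cdot>\<^sub>m g | c. c \<noteq> 0} U"
      unfolding PGL_act_def by (rule UN_upper[OF g_mem])
    moreover have "PGL_act {c \<cdot>\<^sub>m g | c. c \<noteq> 0} U \<subseteq> (\<lambda>v. g *\<^sub>v v) ` U"
      unfolding PGL_act_def using sub by (intro UN_least) (elim CollectE exE conjE, simp only:)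
    ultimately show ?thesis by (rule equalityI[rotated])
  qed
  have "carrier (PGL TYPE('a) n) = (\<lambda>g. ?H #>\<^bsub>GL TYPE('a) n\<^esub> g) ` carrier (GL TYPE('a) n)"
    unfolding PGL_def FactGroup_def RCOSETS_def by (simp add: UNION_singleton_eq_range)
  also have "\<dots> = (\<lambda>g. {c \<cdot>\<^sub>m g | c. c \<noteq> 0}) ` {g \<in> carrier_mat n n. det g \<noteq> 0}"
    unfolding carrier_GL by (rule image_cong[OF refl], rule coset) (elim CollectE conjE)
  finally have carrier_PGL: "carrier (PGL TYPE('a) n) =
      (\<lambda>g. {c \<cdot>\<^sub>m g | c. c \<noteq> 0}) ` {g \<in> carrier_mat n n. det g \<noteq> 0}" .
  have "PGL_orbit n Us = (\<lambda>\<gamma>. map (PGL_act \<gamma>) Us) ` carrier (PGL TYPE('a) n)"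
    unfolding PGL_orbit_def orbit_def by (rule Setcompr_eq_image)
  also have "\<dots> = (\<lambda>g. map (PGL_act {c \<cdot>\<^sub>m g | c. c \<noteq> 0}) Us) ` {g \<in> carrier_mat n n. det g \<noteq> 0}"
    unfolding carrier_PGL image_image ..
  also have "\<dots> = (\<lambda>g. map (\<lambda>U. (\<lambda>v. g *\<^sub>v v) ` U) Us) ` {g \<in> carrier_mat n n. det g \<noteq> 0}"
  proof (rule image_cong[OF refl])
    fix g :: "'a mat" assume "g \<in> {g \<in> carrier_mat n n. det g \<noteq> 0}"
    then have g: "g \<in> carrier_mat n n" by simp
    show "map (PGL_act {c \<cdot>\<^sub>m g | c. c \<noteq> 0}) Us = map (\<lambda>U. (\<lambda>v. g *\<^sub>v v) ` U) Us"
    proof (rule map_cong[OF refl])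
      fix U assume "U \<in> set Us"
      then obtain d where "U \<in> Gr d n" using Us by (auto simp: in_Gr_prod_iff in_set_conv_nth)
      then show "PGL_act {c \<cdot>\<^sub>m g | c. c \<noteq> 0} U = (\<lambda>v. g *\<^sub>v v) ` U" by (rule act[OF g])
    qed
  qed
  finally show ?thesis by auto
qed

lemma PGL_orbit_subset:
  fixes Us :: "'a::field vec set list"
  assumes Us: "Us \<in> Gr_prod ds n"
  shows "PGL_orbit n Us \<subseteq> Gr_prod ds n"
proof -
  have "(\<lambda>v. g *\<^sub>v v) ` U \<in> Gr d n"
    if g: "g \<in> carrier_mat n n" "det g \<noteq> 0" and U: "U \<in> Gr d n" for g d and U :: "'a vec set"
  proof -
    obtain M where M: "full_column_rank n d M" "U = mat_range M" using Gr_is_range[OF U] .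
    then have "M \<in> carrier_mat n d" by (simp add: full_column_rank_def)
    then have "(\<lambda>v. g *\<^sub>v v) ` U = mat_range (g * M)" using mat_range_mult g M by metis
    then show ?thesis
      using basis_matrix_if_full_column_rank(1) full_column_rank_mult_left[OF M(1) g] by metis
  qed
  then show ?thesis using Us by (auto simp: PGL_orbit_eq[OF Us] in_Gr_prod_iff)
qed

definition vanishes_on ::
    "nat \<Rightarrow> ((nat \<times> nat set \<Rightarrow> 'a::field) \<Rightarrow> 'a) \<Rightarrow> 'a vec set list set \<Rightarrow> bool" where
  "vanishes_on n F X \<longleftrightarrow> (\<forall>Us\<in>X. \<forall>Ms. list_all2 (basis_matrix n) Us Ms \<longrightarrow> F (pluecker Ms) = 0)"

text \<open>Closed sets are intersections of hypersurfaces, so density can be tested on single equations.\<close>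

lemma dense_orbit_iff:
  fixes Us :: "'a::field vec set list"
  assumes Us: "Us \<in> Gr_prod ds n"
  shows "zariski_closed ds n hull PGL_orbit n Us = Gr_prod ds n \<longleftrightarrow>
    (\<forall>F e. multihomogeneous ds n e F \<longrightarrow> vanishes_on n F (PGL_orbit n Us) \<longrightarrow>
      vanishes_on n F (Gr_prod ds n))"
proof
  assume hull: "zariski_closed ds n hull PGL_orbit n Us = Gr_prod ds n"
  show "\<forall>F e. multihomogeneous ds n e F \<longrightarrow> vanishes_on n F (PGL_orbit n Us) \<longrightarrow>
      vanishes_on n F (Gr_prod ds n)"
  proof (intro allI impI)
    fix F :: "(nat \<times> nat set \<Rightarrow> 'a) \<Rightarrow> 'a" and e
    assume F: "multihomogeneous ds n e F" "vanishes_on n F (PGL_orbit n Us)"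
    have "zariski_closed ds n (zero_locus ds n {F})"
      unfolding zariski_closed_def using F(1) by (intro exI[of _ "{F}"]) auto
    moreover have "PGL_orbit n Us \<subseteq> zero_locus ds n {F}"
      using F(2) PGL_orbit_subset[OF Us] by (auto simp: zero_locus_def vanishes_on_def)
    ultimately have "Gr_prod ds n \<subseteq> zero_locus ds n {F}" using hull by (auto simp: hull_def)
    then show "vanishes_on n F (Gr_prod ds n)" by (auto simp: zero_locus_def vanishes_on_def)
  qed
next
  assume *: "\<forall>F e. multihomogeneous ds n e F \<longrightarrow> vanishes_on n F (PGL_orbit n Us) \<longrightarrow>
      vanishes_on n F (Gr_prod ds n)"
  have closed: "zariski_closed ds n (Gr_prod ds n :: 'a vec set list set)"
    unfolding zariski_closed_def by (rule exI[of _ "{}"]) (auto simp: zero_locus_def)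
  have "Gr_prod ds n \<subseteq> Z" if Z: "zariski_closed ds n Z" "PGL_orbit n Us \<subseteq> Z" for Z
  proof -
    obtain S where S: "\<forall>F\<in>S. \<exists>e. multihomogeneous ds n e F" "Z = zero_locus ds n S"
      using Z(1) by (auto simp: zariski_closed_def)
    have "vanishes_on n F (Gr_prod ds n)" if "F \<in> S" for F
    proof -
      have "vanishes_on n F (PGL_orbit n Us)"
        using Z(2) that by (auto simp: S(2) zero_locus_def vanishes_on_def)
      then show ?thesis using * S(1) that by blast
    qed
    then show ?thesis by (auto simp: S(2) zero_locus_def vanishes_on_def)
  qed
  moreover have "zariski_closed ds n hull PGL_orbit n Us \<subseteq> Gr_prod ds n"
    using PGL_orbit_subset[OF Us] closed by (rule hull_minimal)
  ultimately show "zariski_closed ds n hull PGL_orbit n Us = Gr_prod ds n"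
    by (auto simp: hull_def)
qed

section \<open>From dense orbits of matrices to dense orbits of subspaces\<close>

lemma mat_poly_minor:
  assumes B: "poly_map m N n d B" and J: "J \<subseteq> {..<n}" "card J = d"
  shows "mat_poly m N (\<lambda>A. det (submatrix (B A) J UNIV))"
proof -
  have cJ: "card {r. r < n \<and> r \<in> J} = d" using J by (auto intro: arg_cong[of _ _ card])
  have pick: "pick J r < n" if "r < d" for r
    using pick_le[of r n J] cJ that by simp
  have "mat_poly m N (\<lambda>A. det (mat d d (\<lambda>(r, c). B A $$ (pick J r, c))))"
    by (intro mat_poly_det[of _ _ d] poly_map_mat poly_map_entry[OF B] pick)
  then show ?thesis
  proof (rule mat_poly.cong)
    fix A :: "'a mat" assume "A \<in> carrier_mat m N"
    then have "B A \<in> carrier_mat n d" by (rule poly_map_carrier[OF B])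
    then have "submatrix (B A) J UNIV = mat d d (\<lambda>(r, c). B A $$ (pick J r, c))"
      using cJ by (intro eq_matI) (auto simp: submatrix_def pick_UNIV)
    then show "det (mat d d (\<lambda>(r, c). B A $$ (pick J r, c))) = det (submatrix (B A) J UNIV)"
      by simp
  qed
qed

context column_blocks
begin

definition blocks :: "'a mat \<Rightarrow> 'a mat list" where
  "blocks Q = map (\<lambda>i. block i Q) [0..<length ds]"

lemma length_blocks [simp]: "length (blocks Q) = length ds" by (simp add: blocks_def)

lemma nth_blocks [simp]: "i < length ds \<Longrightarrow> blocks Q ! i = block i Q" by (simp add: blocks_def)

lemma poly_map_block:
  assumes i: "i < length ds"
  shows "poly_map n (sum_list ds) n (ds ! i) (block i :: 'a::comm_ring_1 mat \<Rightarrow> _)"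
proof (rule poly_mapI)
  fix r c assume "r < n" "c < ds ! i"
  then show "mat_poly n (sum_list ds) (\<lambda>A :: 'a mat. block i A $$ (r, c))"
    using blk_off_tau(1)[OF i, of c]
    by (intro mat_poly.cong[OF mat_poly.entry[of r n "\<tau> (i, c)"]]) (auto simp: block_def)
qed simp

lemma blocks_join:
  assumes "length Ms = length ds" "\<And>i. i < length ds \<Longrightarrow> Ms ! i \<in> carrier_mat n (ds ! i)"
  shows "blocks (join n ((!) Ms)) = Ms"
  using assms by (intro nth_equalityI) (auto simp: block_join)

text \<open>Pluecker coordinates are polynomials in the entries of basis matrices, so a multihomogeneous equation
  on the product of Grassmannians pulls back to a polynomial on matrices. If the latter vanishes on a
  dense set of matrices, it vanishes at all basis matrices. The bound \<open>d \<le> n\<close> makes matrices with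
  injective blocks exist, and a dense orbit has to contain one; then all its members have injective
  blocks and define points of the Grassmannians.\<close>

lemma dense_if_orbit_generic:
  fixes Q :: "'a::field mat"
  assumes Q: "orbit_generic GL_blocks n (sum_list ds) Q"
    and ds: "\<And>d. d \<in> set ds \<Longrightarrow> d \<le> n"
  shows "\<exists>Us :: 'a vec set list \<in> Gr_prod ds n. zariski_closed ds n hull PGL_orbit n Us = Gr_prod ds n"
proof -
  have Qc: "Q \<in> carrier_mat n (sum_list ds)" using Q by (simp add: orbit_generic_def)
  \<comment> \<open>Otherwise the upper minor of block \<open>i\<close> vanishes on the whole orbit, hence identically.\<close>
  have rank: "full_column_rank n (ds ! i) (block i Q)" if i: "i < length ds" for i
  proof (rule ccontr)
    assume not_full: "\<not> full_column_rank n (ds ! i) (block i Q)"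
    have di: "ds ! i \<le> n" using ds i by simp
    let ?f = "\<lambda>A :: 'a mat. det (mat (ds ! i) (ds ! i) (\<lambda>(r, c). block i A $$ (r, c)))"
    have "?f A = 0" if "A \<in> carrier_mat n (sum_list ds)" for A
    proof (rule orbit_genericD[OF Q _ _ that])
      show "mat_poly n (sum_list ds) ?f"
        using di by (intro mat_poly_det[of _ _ "ds ! i"] poly_map_mat poly_map_entry[OF poly_map_block[OF i]]) auto
      fix g D :: "'a mat" assume g: "g \<in> carrier_mat n n" "det g \<noteq> 0" and "D \<in> GL_blocks"
      then obtain h where D: "D = block_diag h" and h: "h i \<in> carrier_mat (ds ! i) (ds ! i)" "det (h i) \<noteq> 0"
        using i by (auto simp: GL_blocks_def)
      let ?M = "block i (g * Q * D)"
      have M: "?M = g * block i Q * h i"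
        using block_mult_block_diag[of "g * Q" n i h] block_mult[OF g(1) Qc i] g Qc i h D by simp
      have Mc: "?M \<in> carrier_mat n (ds ! i)" unfolding M
        by (rule mult_carrier_mat[OF mult_carrier_mat[OF g(1) block_carrier[OF Qc]] h(1)])
      show "?f (g * Q * D) = 0"
      proof (rule ccontr)
        assume "?f (g * Q * D) \<noteq> 0"
        then have "full_column_rank n (ds ! i) ?M"
          using full_column_rank_if_det_upper_rows[OF Mc di] Mc by (simp add: upper_rows_def)
        moreover obtain g' where g': "g' \<in> carrier_mat n n" "det g' \<noteq> 0" "g' * g = 1\<^sub>m n"
          using mat_inverse_if_det_nonzero[OF g] by metis
        moreover obtain h' where h': "h' \<in> carrier_mat (ds ! i) (ds ! i)" "det h' \<noteq> 0"
          "h i * h' = 1\<^sub>m (ds ! i)"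
          using mat_inverse_if_det_nonzero[OF h] by metis
        ultimately have "full_column_rank n (ds ! i) (g' * ?M * h')"
          by (intro full_column_rank_mult_right full_column_rank_mult_left)
        also have "g' * ?M * h' = (g' * g) * block i Q * (h i * h')"
        proof -
          have B: "block i Q \<in> carrier_mat n (ds ! i)" using Qc by simp
          note gB = mult_carrier_mat[OF g(1) B] and g'g = mult_carrier_mat[OF g'(1) g(1)]
          have "g' * ?M * h' = g' * (g * block i Q) * h i * h'"
            unfolding M using assoc_mult_mat[OF g'(1) gB h(1)] by simp
          also have "g' * (g * block i Q) = g' * g * block i Q"
            using assoc_mult_mat[OF g'(1) g(1) B] by simp
          finally show ?thesis
            using assoc_mult_mat[OF mult_carrier_mat[OF g'g B] h(1) h'(1)] by simp
        qed
        also have "\<dots> = block i Q" unfolding g'(3) h'(3)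
          using left_mult_one_mat[OF block_carrier[OF Qc]] right_mult_one_mat[OF block_carrier[OF Qc]] by simp
        finally show False using not_full by simp
      qed
    qed
    moreover have "?f (join n (\<lambda>i. mat n (ds ! i) (\<lambda>(r, c). if r = c then 1 else 0))) = 1"
    proof -
      have "mat (ds ! i) (ds ! i) (\<lambda>(r, c). block i (join n (\<lambda>i. mat n (ds ! i)
          (\<lambda>(r, c). if r = c then 1 else 0))) $$ (r, c)) = (1\<^sub>m (ds ! i) :: 'a mat)"
        using i di by (intro eq_matI) (auto simp: block_join)
      then show ?thesis by simp
    qed
    ultimately show False by simp
  qed
  define Us where "Us = map mat_range (blocks Q)"
  have Us: "Us \<in> Gr_prod ds n"
    using rank basis_matrix_if_full_column_rank(1) by (auto simp: Us_def in_Gr_prod_iff)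
  have "vanishes_on n F (Gr_prod ds n)"
    if F: "multihomogeneous ds n e F" and van: "vanishes_on n F (PGL_orbit n Us)" for F e
  proof -
    have poly: "mat_poly n (sum_list ds) (\<lambda>A. F (pluecker (blocks A)))"
      using F
    proof induction
      case (var i J)
      then have "mat_poly n (sum_list ds) (\<lambda>A :: 'a mat. det (submatrix (block i A) J UNIV))"
        by (intro mat_poly_minor[OF poly_map_block]) auto
      then show ?case using var by (simp add: pluecker_def)
    next
      case (const c)
      show ?case by (rule mat_poly.const)
    next
      case (add e F G)
      show ?case by (rule mat_poly.add[OF add.IH])
    next
      case (mult e F e' G)
      show ?case by (rule mat_poly.mult[OF mult.IH])
    qed
    have zero: "F (pluecker (blocks A)) = 0" if "A \<in> carrier_mat n (sum_list ds)" for A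
    proof (rule orbit_genericD[OF Q poly _ that])
      fix g D :: "'a mat" assume g: "g \<in> carrier_mat n n" "det g \<noteq> 0" and "D \<in> GL_blocks"
      then obtain h where D: "D = block_diag h"
        and h: "\<And>i. i < length ds \<Longrightarrow> h i \<in> carrier_mat (ds ! i) (ds ! i) \<and> det (h i) \<noteq> 0"
        by (auto simp: GL_blocks_def)
      have M: "block i (g * Q * D) = g * block i Q * h i" if i: "i < length ds" for i
        unfolding D block_mult[OF g(1) Qc i, symmetric]
        using block_mult_block_diag[OF mult_carrier_mat[OF g(1) Qc] i, of h] h[OF i] by blast
      have bas: "basis_matrix n ((\<lambda>v. g *\<^sub>v v) ` mat_range (block i Q)) (block i (g * Q * D))"
        if i: "i < length ds" for i
      proof -
        have "full_column_rank n (ds ! i) (block i (g * Q * D))"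
          unfolding M[OF i] using h[OF i]
          by (intro full_column_rank_mult_right full_column_rank_mult_left rank i g) auto
        moreover have "mat_range (block i (g * Q * D)) = (\<lambda>v. g *\<^sub>v v) ` mat_range (block i Q)"
          unfolding M[OF i] using h[OF i] g Qc
          by (simp add: mat_range_mult_invertible[of _ n "ds ! i"] mat_range_mult[of _ n "ds ! i" _ n])
        ultimately show ?thesis using basis_matrix_if_full_column_rank(2) by metis
      qed
      have "map (\<lambda>U. (\<lambda>v. g *\<^sub>v v) ` U) Us \<in> PGL_orbit n Us"
        using g by (auto simp: PGL_orbit_eq[OF Us])
      moreover have "list_all2 (basis_matrix n) (map (\<lambda>U. (\<lambda>v. g *\<^sub>v v) ` U) Us) (blocks (g * Q * D))"
        using bas by (auto simp: list_all2_conv_all_nth Us_def)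
      ultimately show "F (pluecker (blocks (g * Q * D))) = 0"
        using van by (auto simp: vanishes_on_def)
    qed
    show ?thesis
      unfolding vanishes_on_def
    proof (intro ballI allI impI)
      fix Vs :: "'a vec set list" and Ms
      assume Vs: "Vs \<in> Gr_prod ds n" and Ms: "list_all2 (basis_matrix n) Vs Ms"
      have len: "length Vs = length ds" "length Ms = length ds"
        using Vs Ms by (simp_all add: in_Gr_prod_iff list_all2_conv_all_nth)
      have "Ms ! i \<in> carrier_mat n (ds ! i)" if i: "i < length ds" for i
      proof -
        have "Vs ! i \<in> Gr (ds ! i) n" using Vs i by (simp add: in_Gr_prod_iff)
        moreover have "basis_matrix n (Vs ! i) (Ms ! i)"
          using Ms i len by (simp add: list_all2_conv_all_nth)
        ultimately show ?thesis
          using full_column_rank_if_basis_matrix(1) by (auto simp only: full_column_rank_def)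
      qed
      with len(2) have "blocks (join n ((!) Ms)) = Ms" by (rule blocks_join)
      then show "F (pluecker Ms) = 0" using zero[OF join_carrier, of "(!) Ms"] by simp
    qed
  qed
  then have "zariski_closed ds n hull PGL_orbit n Us = Gr_prod ds n"
    unfolding dense_orbit_iff[OF Us] by blast
  with Us show ?thesis by (rule rev_bexI)
qed

end

section \<open>From dense orbits of subspaces to dense orbits of matrices\<close>

lemma index_mult_mat_sum:
  assumes "A \<in> carrier_mat r k" "B \<in> carrier_mat k c" "i < r" "j < c"
  shows "(A * B) $$ (i, j) = (\<Sum>l = 0..<k. A $$ (i, l) * B $$ (l, j))"
  using assms by (simp add: scalar_prod_def)

lemma submatrix_upper_rows:
  assumes "M \<in> carrier_mat m d" "d \<le> m"
  shows "submatrix M {..<d} UNIV = upper_rows d M"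
proof -
  have "{i. i < m \<and> i \<in> {..<d}} = {..<d}" using assms by auto
  moreover have "pick {..<d} i = i" if "i < d" for i
  proof -
    have "{a \<in> {..<d}. a < i} = {..<i}" using that by auto
    then show ?thesis using pick_card_in_set[of i "{..<d}"] that by simp
  qed
  ultimately show ?thesis
    using assms by (intro eq_matI) (auto simp: submatrix_def upper_rows_def pick_UNIV)
qed

text \<open>Let \<open>T\<close> be the upper square part of \<open>M\<close>. By Cramer's rule the entries of \<open>M adj(T)\<close> are maximal
  minors of \<open>M\<close> up to a factor 1, -1 or 0: for a row \<open>r\<close> below \<open>T\<close> the entry \<open>(r, c)\<close> is the signed minor in which row \<open>r\<close> replaces
  row \<open>c\<close>. This is why the affine coordinates \<open>M T\<inverse>\<close> on the chart \<open>det T \<noteq> 0\<close> of the Grassmannian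
  are quotients of Pluecker coordinates.\<close>

lemma mult_adj_upper_rows_minor:
  fixes r c d m :: nat
  assumes r: "r < m" and c: "c < d" and d: "d \<le> m"
  shows "\<exists>J (\<epsilon> :: 'a::comm_ring_1). J \<subseteq> {..<m} \<and> card J = d \<and>
    (\<forall>M\<in>carrier_mat m d. (M * adj_mat (upper_rows d M)) $$ (r, c) = \<epsilon> * det (submatrix M J UNIV))"
proof (cases "r < d")
  case True
  have "(M * adj_mat (upper_rows d M)) $$ (r, c) =
      (if r = c then 1 else 0) * det (submatrix M {..<d} UNIV)"
    if M: "(M :: 'a mat) \<in> carrier_mat m d" for M
  proof -
    have T: "upper_rows d M \<in> carrier_mat d d" using M by (simp add: upper_rows_def)
    note adj = adj_mat[OF T]
    have "(M * adj_mat (upper_rows d M)) $$ (r, c) = (upper_rows d M * adj_mat (upper_rows d M)) $$ (r, c)"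
      using M T adj(1) r c d True by (auto simp: scalar_prod_def upper_rows_def)
    also have "\<dots> = (if r = c then 1 else 0) * det (upper_rows d M)"
      unfolding adj(2) using True c by simp
    finally show ?thesis using submatrix_upper_rows[OF M d] by simp
  qed
  then show ?thesis using d by (intro exI[of _ "{..<d}"] exI[of _ "if r = c then 1 else 0"]) auto
next
  case False
  define J where "J = insert r ({..<d} - {c})"
  have J: "J \<subseteq> {..<m}" "card J = d" using r c d False by (auto simp: J_def card_insert_if)
  have JI: "{i. i < m \<and> i \<in> J} = J" using J by auto
  \<comment> \<open>Listed in increasing order, \<open>J\<close> skips \<open>c\<close> and ends with \<open>r\<close>.\<close>
  have pick: "pick J i = (if i < c then i else if i < d - 1 then Suc i else r)" if i: "i < d" for i
  proof -
    have *: "pick J (card {a \<in> J. a < x}) = x" if "x \<in> J" for x using pick_card_in_set[OF that] .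
    consider "i < c" | "c \<le> i" "i < d - 1" | "i = d - 1" "c \<le> i" using i c by linarith
    then show ?thesis
    proof cases
      case 1
      then have "{a \<in> J. a < i} = {..<i}" using i False by (auto simp: J_def)
      then show ?thesis using *[of i] 1 i by (simp add: J_def)
    next
      case 2
      then have "{a \<in> J. a < Suc i} = {..<Suc i} - {c}" using False by (auto simp: J_def)
      then have "card {a \<in> J. a < Suc i} = i" using 2 by simp
      moreover have "Suc i \<in> J" using 2 by (auto simp: J_def)
      ultimately have "pick J i = Suc i" using *[of "Suc i"] by simp
      then show ?thesis using 2 by simp
    next
      case 3
      then have "{a \<in> J. a < r} = {..<d} - {c}" using False by (auto simp: J_def)
      then have "card {a \<in> J. a < r} = i" using 3 c by simp
      then show ?thesis using *[of r] 3 i by (simp add: J_def)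
    qed
  qed
  have "(M * adj_mat (upper_rows d M)) $$ (r, c) = (- 1) ^ (d - 1 + c) * det (submatrix M J UNIV)"
    if M: "(M :: 'a mat) \<in> carrier_mat m d" for M
  proof -
    let ?S = "submatrix M J UNIV" and ?T = "upper_rows d M"
    have T: "?T \<in> carrier_mat d d" using M by (simp add: upper_rows_def)
    have S: "?S \<in> carrier_mat d d" using M J JI by (intro carrier_matI) (simp_all add: dim_submatrix)
    have S_entry: "?S $$ (i, l) = M $$ (pick J i, l)" if "i < d" "l < d" for i l
      using M J JI that by (simp add: submatrix_def pick_UNIV)
    have cof: "cofactor ?S (d - 1) l = (- 1) ^ (d - 1 + c) * cofactor ?T c l" if l: "l < d" for l
    proof -
      have "mat_delete ?S (d - 1) l = mat_delete ?T c l"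
      proof (rule eq_matI)
        fix i j assume "i < dim_row (mat_delete ?T c l)" "j < dim_col (mat_delete ?T c l)"
        then have ij: "i < d - 1" "j < d - 1" using T by (simp_all add: mat_delete_def)
        then show "mat_delete ?S (d - 1) l $$ (i, j) = mat_delete ?T c l $$ (i, j)"
          using M S T d by (simp add: mat_delete_def S_entry pick) (auto simp: upper_rows_def)
      qed (use S T in \<open>simp_all add: mat_delete_def\<close>)
      moreover have "(- 1 :: 'a) ^ (d - 1 + l) = (- 1) ^ (d - 1 + c) * (- 1) ^ (c + l)"
      proof -
        have "(- 1 :: 'a) ^ c * (- 1) ^ c = 1" by (simp add: power_mult_distrib[symmetric])
        then have "(- 1 :: 'a) ^ (d - 1 + l) = (- 1) ^ (d - 1) * ((- 1) ^ c * (- 1) ^ c) * (- 1) ^ l"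
          by (simp add: power_add)
        also have "\<dots> = (- 1) ^ (d - 1 + c) * (- 1) ^ (c + l)" by (simp only: power_add mult.assoc)
        finally show ?thesis .
      qed
      ultimately show ?thesis by (simp add: cofactor_def mult.assoc)
    qed
    \<comment> \<open>Expansion along the last row, which is row \<open>r\<close> of \<open>M\<close>.\<close>
    have "det ?S = (\<Sum>l<d. ?S $$ (d - 1, l) * cofactor ?S (d - 1) l)"
      using c by (intro laplace_expansion_row[OF S]) auto
    also have "\<dots> = (\<Sum>l<d. (- 1) ^ (d - 1 + c) * (M $$ (r, l) * cofactor ?T c l))"
    proof (rule sum.cong[OF refl])
      fix l assume "l \<in> {..<d}"
      then have l: "l < d" by simp
      have "pick J (d - 1) = r" using pick[of "d - 1"] c by auto
      then have "?S $$ (d - 1, l) = M $$ (r, l)" using S_entry[of "d - 1" l] l c by simp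
      then show "?S $$ (d - 1, l) * cofactor ?S (d - 1) l =
          (- 1) ^ (d - 1 + c) * (M $$ (r, l) * cofactor ?T c l)"
        unfolding cof[OF l] by (simp only: mult.left_commute)
    qed
    also have "\<dots> = (- 1) ^ (d - 1 + c) * (M * adj_mat ?T) $$ (r, c)"
      using M T r c by (simp add: sum_distrib_left scalar_prod_def adj_mat_def atLeast0LessThan)
    finally show ?thesis
      by (simp add: mult.assoc[symmetric] power_mult_distrib[symmetric])
  qed
  then show ?thesis using J by blast
qed

context column_blocks
begin

definition upper_minors :: "'a::comm_ring_1 mat \<Rightarrow> 'a" where
  "upper_minors A = (\<Prod>i<length ds. det (upper_rows (ds ! i) (block i A)))"

text \<open>Functions on the chart where no upper minor vanishes that become multihomogeneous polynomials in the
  Pluecker coordinates after multiplication by a power of the product of the upper minors. The same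
  power is used for all factors, which makes degrees easy to match in sums.\<close>

definition regular_in_pluecker :: "nat \<Rightarrow> ('a::field mat \<Rightarrow> 'a) \<Rightarrow> bool" where
  "regular_in_pluecker m u \<longleftrightarrow> (\<exists>k F. multihomogeneous ds m (\<lambda>j. if j < length ds then k else 0) F \<and>
     (\<forall>A\<in>carrier_mat m (sum_list ds). upper_minors A \<noteq> 0 \<longrightarrow>
       F (pluecker (blocks A)) = upper_minors A ^ k * u A))"

context
  fixes m :: nat
  assumes ds_le: "\<And>d. d \<in> set ds \<Longrightarrow> d \<le> m"
begin

lemma pluecker_upper_minor:
  assumes "A \<in> carrier_mat m (sum_list ds)" "i < length ds"
  shows "pluecker (blocks A) (i, {..<ds ! i}) = det (upper_rows (ds ! i) (block i A))"
  using assms ds_le submatrix_upper_rows[of "block i A" m "ds ! i"] by (simp add: pluecker_def)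

lemma multihomogeneous_prod_upper:
  assumes I: "I \<subseteq> {..<length ds}"
  shows "multihomogeneous ds m (\<lambda>j. if j \<in> I then 1 else 0)
    (\<lambda>p :: _ \<Rightarrow> 'a::field. \<Prod>i\<in>I. p (i, {..<ds ! i}))"
proof -
  have "finite I" using I finite_subset by auto
  then show ?thesis using I
  proof induction
    case (insert i I)
    have "multihomogeneous ds m (\<lambda>j. (if j = i then 1 else 0) + (if j \<in> I then 1 else 0))
        (\<lambda>p :: _ \<Rightarrow> 'a. p (i, {..<ds ! i}) * (\<Prod>i\<in>I. p (i, {..<ds ! i})))"
      using insert ds_le by (intro multihomogeneous.mult multihomogeneous.var) auto
    moreover have "(\<lambda>j. (if j = i then 1 else 0) + (if j \<in> I then 1 else 0)) =
        (\<lambda>j. if j \<in> insert i I then 1 else 0 :: nat)" using insert by auto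
    ultimately show ?case using insert by simp
  qed (simp add: multihomogeneous.const)
qed

lemma multihomogeneous_upper_power:
  "multihomogeneous ds m (\<lambda>j. if j < length ds then k else 0)
    (\<lambda>p :: _ \<Rightarrow> 'a::field. (\<Prod>i<length ds. p (i, {..<ds ! i})) ^ k)"
proof (induction k)
  case (Suc k)
  have "multihomogeneous ds m (\<lambda>j. (if j \<in> {..<length ds} then 1 else 0) + (if j < length ds then k else 0))
    (\<lambda>p :: _ \<Rightarrow> 'a. (\<Prod>i<length ds. p (i, {..<ds ! i})) * (\<Prod>i<length ds. p (i, {..<ds ! i})) ^ k)"
    by (intro multihomogeneous.mult multihomogeneous_prod_upper Suc) auto
  moreover have "(\<lambda>j. (if j \<in> {..<length ds} then 1 else 0) + (if j < length ds then k else 0)) =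
      (\<lambda>j. if j < length ds then Suc k else 0)" by auto
  ultimately show ?case by simp
qed (simp add: multihomogeneous.const)

lemma prod_pluecker_upper:
  "A \<in> carrier_mat m (sum_list ds) \<Longrightarrow>
    (\<Prod>i<length ds. pluecker (blocks A) (i, {..<ds ! i})) = upper_minors A"
  by (simp add: upper_minors_def pluecker_upper_minor)

lemma regular_const: "regular_in_pluecker m (\<lambda>_. c :: 'a::field)"
  unfolding regular_in_pluecker_def
  by (intro exI[of _ 0] exI[of _ "\<lambda>_. c"]) (auto intro: multihomogeneous.const)

lemma regular_mult:
  fixes u v :: "'a::field mat \<Rightarrow> 'a"
  assumes "regular_in_pluecker m u" "regular_in_pluecker m v"
  shows "regular_in_pluecker m (\<lambda>A. u A * v A)"
proof -
  obtain k F where F: "multihomogeneous ds m (\<lambda>j. if j < length ds then k else 0) F"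
    "\<And>A. A \<in> carrier_mat m (sum_list ds) \<Longrightarrow> upper_minors A \<noteq> 0 \<Longrightarrow>
       F (pluecker (blocks A)) = upper_minors A ^ k * u A"
    using assms(1) by (auto simp: regular_in_pluecker_def)
  obtain l G where G: "multihomogeneous ds m (\<lambda>j. if j < length ds then l else 0) G"
    "\<And>A. A \<in> carrier_mat m (sum_list ds) \<Longrightarrow> upper_minors A \<noteq> 0 \<Longrightarrow>
       G (pluecker (blocks A)) = upper_minors A ^ l * v A"
    using assms(2) by (auto simp: regular_in_pluecker_def)
  have "(\<lambda>j. (if j < length ds then k else 0) + (if j < length ds then l else 0)) =
      (\<lambda>j. if j < length ds then k + l else 0)" by auto
  then have "multihomogeneous ds m (\<lambda>j. if j < length ds then k + l else 0) (\<lambda>p. F p * G p)"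
    using multihomogeneous.mult[OF F(1) G(1)] by simp
  then show ?thesis
    unfolding regular_in_pluecker_def using F(2) G(2)
    by (intro exI[of _ "k + l"] exI[of _ "\<lambda>p. F p * G p"]) (auto simp: power_add)
qed

lemma regular_add:
  fixes u v :: "'a::field mat \<Rightarrow> 'a"
  assumes "regular_in_pluecker m u" "regular_in_pluecker m v"
  shows "regular_in_pluecker m (\<lambda>A. u A + v A)"
proof -
  obtain k F where F: "multihomogeneous ds m (\<lambda>j. if j < length ds then k else 0) F"
    "\<And>A. A \<in> carrier_mat m (sum_list ds) \<Longrightarrow> upper_minors A \<noteq> 0 \<Longrightarrow>
       F (pluecker (blocks A)) = upper_minors A ^ k * u A"
    using assms(1) by (auto simp: regular_in_pluecker_def)
  obtain l G where G: "multihomogeneous ds m (\<lambda>j. if j < length ds then l else 0) G"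
    "\<And>A. A \<in> carrier_mat m (sum_list ds) \<Longrightarrow> upper_minors A \<noteq> 0 \<Longrightarrow>
       G (pluecker (blocks A)) = upper_minors A ^ l * v A"
    using assms(2) by (auto simp: regular_in_pluecker_def)
  let ?q = "\<lambda>p :: _ \<Rightarrow> 'a. \<Prod>i<length ds. p (i, {..<ds ! i})"
  have eq: "(\<lambda>j. (if j < length ds then a else 0) + (if j < length ds then b else 0)) =
      (\<lambda>j. if j < length ds then a + b else 0)" for a b :: nat by auto
  have "multihomogeneous ds m (\<lambda>j. if j < length ds then k + l else 0)
      (\<lambda>p. F p * ?q p ^ l + G p * ?q p ^ k)"
    using multihomogeneous.mult[OF F(1) multihomogeneous_upper_power[of l]]
      multihomogeneous.mult[OF G(1) multihomogeneous_upper_power[of k]]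
    unfolding eq add.commute[of l k] by (rule multihomogeneous.add)
  then show ?thesis
    unfolding regular_in_pluecker_def using F(2) G(2)
    by (intro exI[of _ "k + l"] exI[of _ "\<lambda>p. F p * ?q p ^ l + G p * ?q p ^ k"])
       (auto simp: power_add prod_pluecker_upper algebra_simps)
qed

lemma regular_sum:
  fixes u :: "'b \<Rightarrow> 'a::field mat \<Rightarrow> 'a"
  assumes "\<And>i. i \<in> I \<Longrightarrow> regular_in_pluecker m (u i)"
  shows "regular_in_pluecker m (\<lambda>A. \<Sum>i\<in>I. u i A)"
  using assms by (induction I rule: infinite_finite_induct) (auto intro: regular_const regular_add)

lemma regular_normalised_entry:
  assumes i: "i < length ds" and r: "r < m" and c: "c < ds ! i"
  shows "regular_in_pluecker m (\<lambda>A :: 'a::field mat.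
    (block i A * adj_mat (upper_rows (ds ! i) (block i A))) $$ (r, c) /
    det (upper_rows (ds ! i) (block i A)))"
proof -
  have di: "ds ! i \<le> m" using ds_le i by simp
  obtain J and \<epsilon> :: 'a where J: "J \<subseteq> {..<m}" "card J = ds ! i"
    and minor: "\<And>M. M \<in> carrier_mat m (ds ! i) \<Longrightarrow>
      (M * adj_mat (upper_rows (ds ! i) M)) $$ (r, c) = \<epsilon> * det (submatrix M J UNIV)"
    using mult_adj_upper_rows_minor[OF r c di] by blast
  let ?I = "{..<length ds} - {i}"
  define F where "F = (\<lambda>p :: _ \<Rightarrow> 'a. \<epsilon> * (p (i, J) * (\<Prod>j\<in>?I. p (j, {..<ds ! j}))))"
  have "multihomogeneous ds m (\<lambda>j. 0 + ((if j = i then 1 else 0) + (if j \<in> ?I then 1 else 0))) F"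
    unfolding F_def
    by (intro multihomogeneous.mult multihomogeneous.const multihomogeneous.var
        multihomogeneous_prod_upper i J) auto
  moreover have "(\<lambda>j. 0 + ((if j = i then 1 else 0) + (if j \<in> ?I then 1 else 0))) =
      (\<lambda>j. if j < length ds then 1 else 0 :: nat)" using i by auto
  ultimately have "multihomogeneous ds m (\<lambda>j. if j < length ds then 1 else 0) F" by simp
  moreover have "F (pluecker (blocks A)) = upper_minors A ^ 1 *
      ((block i A * adj_mat (upper_rows (ds ! i) (block i A))) $$ (r, c) /
        det (upper_rows (ds ! i) (block i A)))"
    if A: "A \<in> carrier_mat m (sum_list ds)" and nz: "upper_minors A \<noteq> 0" for A
  proof -
    have split: "upper_minors A = det (upper_rows (ds ! i) (block i A)) *
        (\<Prod>j\<in>?I. det (upper_rows (ds ! j) (block j A)))"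
      unfolding upper_minors_def using i by (subst prod.remove[of _ i]) auto
    have "F (pluecker (blocks A)) = (\<epsilon> * det (submatrix (block i A) J UNIV)) *
        (\<Prod>j\<in>?I. det (upper_rows (ds ! j) (block j A)))"
      using i pluecker_upper_minor[OF A] by (simp add: F_def) (simp add: pluecker_def)
    then show ?thesis using minor[of "block i A"] A nz by (simp add: split)
  qed
  ultimately show ?thesis unfolding regular_in_pluecker_def by blast
qed

text \<open>With \<open>T\<close> the upper square part of a block \<open>M\<close>, this replaces \<open>M\<close> by \<open>M T\<inverse> h\<close>. If \<open>h\<close> is the identity, this is
  the basis matrix whose upper part is the identity; other \<open>h\<close> give the other basis matrices of the
  same subspace.\<close>

definition normalise :: "(nat \<Rightarrow> 'a::field mat) \<Rightarrow> 'a mat \<Rightarrow> 'a mat" where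
  "normalise h A = join m (\<lambda>i. block i A *
     (inverse (det (upper_rows (ds ! i) (block i A))) \<cdot>\<^sub>m (adj_mat (upper_rows (ds ! i) (block i A)) * h i)))"

lemma regular_compose_normalise:
  fixes f :: "'a::field mat \<Rightarrow> 'a"
  assumes f: "mat_poly m (sum_list ds) f"
    and h: "\<And>i. i < length ds \<Longrightarrow> h i \<in> carrier_mat (ds ! i) (ds ! i)"
  shows "regular_in_pluecker m (\<lambda>A. f (normalise h A))"
  using f
proof induction
  case (entry r j)
  note b = blk_off[OF entry(2)]
  let ?i = "blk j"
  let ?T = "\<lambda>A :: 'a mat. upper_rows (ds ! ?i) (block ?i A)"
  have "regular_in_pluecker m (\<lambda>A :: 'a mat. \<Sum>c = 0..<ds ! ?i.
      (block ?i A * adj_mat (?T A)) $$ (r, c) / det (?T A) * h ?i $$ (c, off j))"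
    using b entry by (intro regular_sum regular_mult regular_const regular_normalised_entry) auto
  moreover have "normalise h A $$ (r, j) = (\<Sum>c = 0..<ds ! ?i.
      (block ?i A * adj_mat (?T A)) $$ (r, c) / det (?T A) * h ?i $$ (c, off j))"
    if A: "A \<in> carrier_mat m (sum_list ds)" for A
  proof -
    have B: "block ?i A \<in> carrier_mat m (ds ! ?i)" using A by simp
    have T: "?T A \<in> carrier_mat (ds ! ?i) (ds ! ?i)" using B by (simp add: upper_rows_def)
    note adj = adj_mat(1)[OF T] and hi = h[OF b(1)]
    have Bh: "block ?i A * adj_mat (?T A) \<in> carrier_mat m (ds ! ?i)" using B adj by simp
    have "block ?i A * (inverse (det (?T A)) \<cdot>\<^sub>m (adj_mat (?T A) * h ?i)) =
        inverse (det (?T A)) \<cdot>\<^sub>m (block ?i A * adj_mat (?T A) * h ?i)"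
      using mult_smult_distrib[OF B mult_carrier_mat[OF adj hi]] assoc_mult_mat[OF B adj hi] by simp
    then have "normalise h A $$ (r, j) =
        inverse (det (?T A)) * (block ?i A * adj_mat (?T A) * h ?i) $$ (r, off j)"
      using entry b B adj hi by (simp add: normalise_def join_def)
    also have "(block ?i A * adj_mat (?T A) * h ?i) $$ (r, off j) =
        (\<Sum>c = 0..<ds ! ?i. (block ?i A * adj_mat (?T A)) $$ (r, c) * h ?i $$ (c, off j))"
      by (rule index_mult_mat_sum[OF Bh hi entry(1) b(2)])
    finally show ?thesis by (simp add: sum_distrib_left divide_inverse mult_ac)
  qed
  ultimately show ?case by (auto simp: regular_in_pluecker_def)
next
  case (const c)
  show ?case by (rule regular_const)
next
  case (add f g)
  show ?case by (rule regular_add[OF add.IH])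
next
  case (mult f g)
  show ?case by (rule regular_mult[OF mult.IH])
next
  case (cong f g)
  have "normalise h A \<in> carrier_mat m (sum_list ds)" for A by (simp add: normalise_def)
  then show ?case using cong by simp
qed

text \<open>Let a polynomial \<open>f\<close> on matrices vanish on the orbit that corresponds to a dense orbit of subspaces.
  For fixed \<open>h\<close> the function \<open>f (normalise h A)\<close> is multihomogeneous in the Pluecker coordinates up to
  a power of the upper minors. Normalisation only changes the bases, so the resulting equation,
  multiplied by the upper minors to cover the complement of the chart, holds on the orbit of subspaces
  and hence everywhere. Choosing \<open>h\<close> as the upper parts of \<open>A\<close> gives \<open>f A = 0\<close> on the chart, and so
  \<open>f = 0\<close>.\<close>

lemma orbit_generic_if_dense:
  fixes Us :: "'a::field vec set list"
  assumes inf: "infinite (UNIV :: 'a set)"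
    and Us: "Us \<in> Gr_prod ds m"
    and dense: "zariski_closed ds m hull PGL_orbit m Us = Gr_prod ds m"
  shows "\<exists>R :: 'a mat. orbit_generic GL_blocks m (sum_list ds) R"
proof -
  have "\<exists>M. full_column_rank m (ds ! i) M \<and> Us ! i = mat_range M" if "i < length ds" for i
    using Gr_is_range[of "Us ! i" "ds ! i" m] Us that by (metis in_Gr_prod_iff)
  then obtain M where M: "\<And>i. i < length ds \<Longrightarrow> full_column_rank m (ds ! i) (M i) \<and> Us ! i = mat_range (M i)"
    by metis
  then have Mc: "\<And>i. i < length ds \<Longrightarrow> M i \<in> carrier_mat m (ds ! i)" by (simp add: full_column_rank_def)
  define R where "R = join m M"
  have "orbit_generic GL_blocks m (sum_list ds) R"
    unfolding orbit_generic_def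
  proof (intro conjI allI impI ballI)
    show "R \<in> carrier_mat m (sum_list ds)" by (simp add: R_def)
    fix f :: "'a mat \<Rightarrow> 'a" and X :: "'a mat"
    assume f: "mat_poly m (sum_list ds) f" and X: "X \<in> carrier_mat m (sum_list ds)"
      and van: "\<forall>g\<in>carrier_mat m m. \<forall>D\<in>GL_blocks. det g \<noteq> 0 \<longrightarrow> f (g * R * D) = 0"
    have normal_zero: "f (normalise h A) = 0"
      if h: "\<And>i. i < length ds \<Longrightarrow> h i \<in> carrier_mat (ds ! i) (ds ! i) \<and> det (h i) \<noteq> 0"
        and A: "A \<in> carrier_mat m (sum_list ds)" and nz: "upper_minors A \<noteq> 0" for h A
    proof -
      have "regular_in_pluecker m (\<lambda>A. f (normalise h A))"
        using h by (intro regular_compose_normalise f) auto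
      then obtain k F where F: "multihomogeneous ds m (\<lambda>j. if j < length ds then k else 0) F"
        and F_eq: "\<And>A. A \<in> carrier_mat m (sum_list ds) \<Longrightarrow> upper_minors A \<noteq> 0 \<Longrightarrow>
          F (pluecker (blocks A)) = upper_minors A ^ k * f (normalise h A)"
        by (auto simp: regular_in_pluecker_def)
      define G where "G = (\<lambda>p. F p * (\<Prod>i<length ds. p (i, {..<ds ! i})))"
      have G: "multihomogeneous ds m
          (\<lambda>j. (if j < length ds then k else 0) + (if j \<in> {..<length ds} then 1 else 0)) G"
        unfolding G_def by (intro multihomogeneous.mult F multihomogeneous_prod_upper) auto
      have "vanishes_on m G (PGL_orbit m Us)"
        unfolding vanishes_on_def
      proof (intro ballI allI impI)
        fix Vs Ms assume "Vs \<in> PGL_orbit m Us" and Ms: "list_all2 (basis_matrix m) Vs Ms"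
        then obtain g where g: "g \<in> carrier_mat m m" "det g \<noteq> 0"
          and Vs: "Vs = map (\<lambda>U. (\<lambda>v. g *\<^sub>v v) ` U) Us"
          by (auto simp: PGL_orbit_eq[OF Us])
        have len: "length Us = length ds" "length Ms = length ds"
          using Us Ms by (auto simp: in_Gr_prod_iff Vs list_all2_conv_all_nth)
        have "\<exists>l. l \<in> carrier_mat (ds ! i) (ds ! i) \<and> det l \<noteq> 0 \<and> Ms ! i = g * M i * l"
          if i: "i < length ds" for i
        proof -
          have gM: "g * M i \<in> carrier_mat m (ds ! i)" using g Mc[OF i] by simp
          have "full_column_rank m (ds ! i) (g * M i)" using M[OF i] g by (intro full_column_rank_mult_left) auto
          moreover have Vi: "Vs ! i = mat_range (g * M i)"
            using i len M[OF i] mat_range_mult[OF Mc[OF i] g(1)] by (simp add: Vs)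
          ultimately have "Vs ! i \<in> Gr (ds ! i) m" using basis_matrix_if_full_column_rank(1) by metis
          moreover have "basis_matrix m (Vs ! i) (Ms ! i)"
            using Ms i len by (simp add: list_all2_conv_all_nth)
          ultimately have "full_column_rank m (ds ! i) (Ms ! i)" "mat_range (Ms ! i) = mat_range (g * M i)"
            using full_column_rank_if_basis_matrix Vi by metis+
          then show ?thesis using mat_range_eqE[OF gM] by metis
        qed
        then obtain l where l: "\<And>i. i < length ds \<Longrightarrow>
            l i \<in> carrier_mat (ds ! i) (ds ! i) \<and> det (l i) \<noteq> 0 \<and> Ms ! i = g * M i * l i"
          by metis
        have Msc: "Ms ! i \<in> carrier_mat m (ds ! i)" if "i < length ds" for i
          using l[OF that] mult_carrier_mat[OF mult_carrier_mat[OF g(1) Mc[OF that]]] by simp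
        define B where "B = join m ((!) Ms)"
        have B: "B \<in> carrier_mat m (sum_list ds)" "blocks B = Ms"
          using blocks_join[OF len(2) Msc] by (simp_all add: B_def)
        have B_block: "block i B = g * M i * l i" if "i < length ds" for i
          using nth_blocks[OF that, of B] l[OF that] by (simp add: B(2))
        show "G (pluecker Ms) = 0"
        proof (cases "upper_minors B = 0")
          case True
          then show ?thesis using prod_pluecker_upper[OF B(1)] by (simp add: G_def B(2))
        next
          case False
          define T where "T = (\<lambda>i. upper_rows (ds ! i) (block i B))"
          define s where "s = (\<lambda>i. inverse (det (T i)) \<cdot>\<^sub>m (adj_mat (T i) * h i))"
          have T: "T i \<in> carrier_mat (ds ! i) (ds ! i)" "det (T i) \<noteq> 0" if "i < length ds" for i
            using B(1) False that by (auto simp: T_def upper_minors_def upper_rows_def block_def)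
          have s: "s i \<in> carrier_mat (ds ! i) (ds ! i)" "det (s i) \<noteq> 0" if i: "i < length ds" for i
          proof -
            note adj = adj_mat[OF T(1)[OF i]]
            show "s i \<in> carrier_mat (ds ! i) (ds ! i)" using adj(1) h[OF i] by (simp add: s_def)
            have "det (T i) * det (adj_mat (T i)) = det (T i) ^ (ds ! i)"
              using det_mult[OF T(1)[OF i] adj(1)] adj(2) by simp
            then have "det (adj_mat (T i)) \<noteq> 0" using T(2)[OF i] by auto
            then show "det (s i) \<noteq> 0"
              using adj(1) h[OF i] T(2)[OF i] by (simp add: s_def det_mult[of _ "ds ! i"])
          qed
          have "normalise h B = g * R * block_diag (\<lambda>i. l i * s i)"
          proof (rule eq_mat_if_blocks_eq)
            fix i assume i: "i < length ds"
            have ls: "l i * s i \<in> carrier_mat (ds ! i) (ds ! i)"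
              using l[OF i] s(1)[OF i] by (blast intro: mult_carrier_mat)
            have gM: "g * M i \<in> carrier_mat m (ds ! i)" using g Mc[OF i] by simp
            have "block i (normalise h B) = block i B * s i"
              unfolding normalise_def
              using block_join[of i "\<lambda>i. block i B * s i" m, OF i
                  mult_carrier_mat[OF block_carrier[OF B(1)] s(1)[OF i]]]
              by (simp only: s_def T_def)
            also have "\<dots> = g * M i * (l i * s i)"
              unfolding B_block[OF i] using l[OF i] s(1)[OF i] by (blast intro: assoc_mult_mat[OF gM])
            also have "g * M i = block i (g * R)"
              using block_mult[OF g(1) _ i, of R] block_join[of i M m] i Mc[OF i] by (simp add: R_def)
            also have "block i (g * R) * (l i * s i) = block i (g * R * block_diag (\<lambda>i. l i * s i))"
              using g i ls by (subst block_mult_block_diag[of _ m]) (auto simp: R_def)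
            finally show "block i (normalise h B) = block i (g * R * block_diag (\<lambda>i. l i * s i))" .
          qed (use g in \<open>auto simp: normalise_def R_def intro!: mult_carrier_mat[of _ m "sum_list ds"] mult_carrier_mat[of _ m m]\<close>)
          moreover have "block_diag (\<lambda>i. l i * s i) \<in> GL_blocks"
            unfolding GL_blocks_def
          proof (intro CollectI exI conjI allI impI)
            fix i assume i: "i < length ds"
            show "l i * s i \<in> carrier_mat (ds ! i) (ds ! i)"
              using l[OF i] s(1)[OF i] by (blast intro: mult_carrier_mat)
            show "det (l i * s i) \<noteq> 0" using l[OF i] s[OF i] by (simp add: det_mult[of _ "ds ! i"])
          qed (rule refl)
          ultimately have "f (normalise h B) = 0" using van g by simp
          then show ?thesis using F_eq[OF B(1) False] by (simp add: G_def B(2))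
        qed
      qed
      then have van_G: "vanishes_on m G (Gr_prod ds m)"
        using G dense dense_orbit_iff[OF Us] by blast
      have rank: "full_column_rank m (ds ! i) (block i A)" if i: "i < length ds" for i
      proof (rule full_column_rank_if_det_upper_rows)
        show "ds ! i \<le> m" using ds_le i by simp
        show "det (upper_rows (ds ! i) (block i A)) \<noteq> 0" using nz i by (auto simp: upper_minors_def)
      qed (use A in simp)
      have "map mat_range (blocks A) \<in> Gr_prod ds m"
        using basis_matrix_if_full_column_rank(1)[OF rank] by (auto simp: in_Gr_prod_iff)
      moreover have "list_all2 (basis_matrix m) (map mat_range (blocks A)) (blocks A)"
        using basis_matrix_if_full_column_rank(2)[OF rank] by (auto simp: list_all2_conv_all_nth)
      ultimately have "G (pluecker (blocks A)) = 0" using van_G by (auto simp: vanishes_on_def)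
      then show ?thesis using F_eq[OF A nz] prod_pluecker_upper[OF A] nz by (simp add: G_def)
    qed
    have "f A * upper_minors A = 0" if A: "A \<in> carrier_mat m (sum_list ds)" for A
    proof (cases "upper_minors A = 0")
      case False
      define T where "T = (\<lambda>i. upper_rows (ds ! i) (block i A))"
      have T: "T i \<in> carrier_mat (ds ! i) (ds ! i)" "det (T i) \<noteq> 0" if "i < length ds" for i
        using A False that by (auto simp: T_def upper_minors_def upper_rows_def block_def)
      have "normalise T A = A"
      proof (rule eq_mat_if_blocks_eq[OF _ A])
        fix i assume i: "i < length ds"
        have inv: "inverse (det (T i)) \<cdot>\<^sub>m (adj_mat (T i) * T i) = 1\<^sub>m (ds ! i)"
          unfolding adj_mat(3)[OF T(1)[OF i]] using T(2)[OF i] by (intro eq_matI) auto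
        have Ai: "block i A * (inverse (det (T i)) \<cdot>\<^sub>m (adj_mat (T i) * T i)) = block i A"
          unfolding inv by (rule right_mult_one_mat[OF block_carrier[OF A]])
        have "normalise T A = join m (\<lambda>i. block i A * (inverse (det (T i)) \<cdot>\<^sub>m (adj_mat (T i) * T i)))"
          by (simp only: normalise_def T_def)
        then show "block i (normalise T A) = block i A"
          using block_join[of i "\<lambda>i. block i A * (inverse (det (T i)) \<cdot>\<^sub>m (adj_mat (T i) * T i))" m] i A
          by (simp add: Ai)
      qed (simp add: normalise_def)
      then show ?thesis using normal_zero[OF _ A False, of T] T by simp
    qed simp
    moreover have "mat_poly m (sum_list ds) (upper_minors :: 'a mat \<Rightarrow> 'a)"
    proof -
      have "mat_poly m (sum_list ds)
          (\<lambda>A :: 'a mat. det (mat (ds ! i) (ds ! i) (\<lambda>(r, c). block i A $$ (r, c))))"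
        if i: "i < length ds" for i
        using i ds_le[of "ds ! i"]
        by (intro mat_poly_det[of _ _ "ds ! i"] poly_map_mat poly_map_entry[OF poly_map_block]) auto
      then show ?thesis
        unfolding upper_minors_def upper_rows_def
        by (intro mat_poly_prod) (simp add: block_def)
    qed
    moreover have "\<exists>B\<in>carrier_mat m (sum_list ds). upper_minors B \<noteq> (0 :: 'a)"
    proof
      let ?B = "join m (\<lambda>i. mat m (ds ! i) (\<lambda>(r, c). if r = c then 1 else 0)) :: 'a mat"
      have "upper_rows (ds ! i) (block i ?B) = 1\<^sub>m (ds ! i)" if i: "i < length ds" for i
      proof -
        have "ds ! i \<le> m" using ds_le i by simp
        then show ?thesis using i by (subst block_join) (auto simp: upper_rows_def intro!: eq_matI)
      qed
      then show "upper_minors ?B \<noteq> 0" by (simp add: upper_minors_def)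
    qed simp
    ultimately show "f X = 0"
      using mat_poly_eq_0_if_mult_eq_0[OF inf f _ _ _ _ X] by blast
  qed
  then show ?thesis by blast
qed

end

end

section \<open>Density of the dimension vector\<close>

theorem lemma4p9:
  fixes a :: "nat list" and b1 b2 n k m :: nat
  assumes "a \<noteq> []"
    and "dimension_vector (a @ [b1, b2]) n"
    and "sum_list a = n - k" and "n - k < n"
    and "k \<le> b1" and "k \<le> b2"
    and "b1 + b2 < n"
    and "m = b1 + b2 - k"
    and "\<forall>ai \<in> set a. ai \<le> m"
    and "dense_dimension_vector TYPE('a::alg_closed_field) (a @ [b1, b2]) m"
  shows "dense_dimension_vector TYPE('a) (a @ [b1, b2]) n"
proof -
  define ds where "ds = a @ [b1, b2]"
  have inf: "infinite (UNIV :: 'a set)" by (rule infinite_UNIV_alg_closed_field)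
  have sum: "sum_list ds = m + n" using assms(3-8) by (simp add: ds_def)
  have le_m: "d \<le> m" if "d \<in> set ds" for d using that assms(5,6,8,9) by (auto simp: ds_def)
  have le_n: "d \<le> n" if "d \<in> set ds" for d
    using that assms(2) by (auto simp: ds_def dimension_vector_def)
  obtain \<tau> where "column_blocks ds \<tau>" using column_blocks_exists by blast
  then interpret column_blocks ds \<tau> .
  interpret L: transpose_stable_group "GL_blocks :: 'a mat set" "sum_list ds"
    by (rule transpose_stable_group_GL_blocks)
  obtain Us :: "'a vec set list" where "Us \<in> Gr_prod ds m"
    "zariski_closed ds m hull PGL_orbit m Us = Gr_prod ds m"
    using assms(10) by (auto simp: dense_dimension_vector_def ds_def)
  then obtain R :: "'a mat" where "orbit_generic GL_blocks m (sum_list ds) R"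
    using orbit_generic_if_dense[OF le_m inf] by blast
  then obtain Q :: "'a mat" where "orbit_generic GL_blocks n (sum_list ds) Q"
    using L.orbit_generic_castling[OF inf sum] by blast
  then show ?thesis
    unfolding dense_dimension_vector_def ds_def[symmetric]
    using dense_if_orbit_generic[OF _ le_n] by blast
qed

end
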